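(* Let $h=\prod_{i=1}^{t}p_i^{s_i}$ with distinct primes $p_i$, $s_i\ge1$, let $1\le r\le m\le n$, and let $\Sigma_r$ be the complement of $\mathrm{Bil}_r(\mathbb{Z}_h^{m\times n})$. Then $\chi(\Sigma_r)=\omega(\Sigma_r)=\alpha(\mathrm{Bil}_r(\mathbb{Z}_h^{m\times n}))=h^{n(m-r)}$. Moreover, the core of $\Sigma_r$ is a maximum clique of $\Sigma_r$, and $\Sigma_r$ is not a core.
   Context: $\mathbb{Z}_h$ is the residue class ring modulo $h$. The inner rank $\rho(A)$ of a nonzero $A\in\mathbb{Z}_h^{m\times n}$ is the least $r$ with $A=BC$, $B\in\mathbb{Z}_h^{m\times r}$, $C\in\mathbb{Z}_h^{r\times n}$; $\rho(0)=0$. $\mathrm{Bil}_r(\mathbb{Z}_h^{m\times n})$ is the graph on $\mathbb{Z}_h^{m\times n}$, distinct $A,B$ adjacent iff $\rho(A-B)\le r$. $\alpha,\omega,\chi$ denote independence number, clique number and chromatic number. A graph is a core if every endomorphism is an automorphism; a core of a graph $\Gamma$ is a subgraph $\Delta$ that is a core and admits a homomorphism $\Gamma\to\Delta$. *)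

theory Defs
  imports Main
begin

text \<open>An m x n matrix over Z_h is represented as a function nat => nat => int whose
entries at positions (i,j) with i < m, j < n are canonical residues in {0..<h}
and which is zero outside the m x n block (so the representation is unique).\<close>

definition zmat :: "nat \<Rightarrow> nat \<Rightarrow> nat \<Rightarrow> (nat \<Rightarrow> nat \<Rightarrow> int) set" where
  "zmat h m n = {A. \<forall>i j. (i < m \<and> j < n \<longrightarrow> 0 \<le> A i j \<and> A i j < int h)
                        \<and> (\<not> (i < m \<and> j < n) \<longrightarrow> A i j = 0)}"

definition zmat_sub :: "nat \<Rightarrow> nat \<Rightarrow> nat \<Rightarrow> (nat \<Rightarrow> nat \<Rightarrow> int) \<Rightarrow> (nat \<Rightarrow> nat \<Rightarrow> int) \<Rightarrow> (nat \<Rightarrow> nat \<Rightarrow> int)" where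
  "zmat_sub h m n A B = (\<lambda>i j. if i < m \<and> j < n then (A i j - B i j) mod int h else 0)"

definition zmat_mult :: "nat \<Rightarrow> nat \<Rightarrow> nat \<Rightarrow> nat \<Rightarrow> (nat \<Rightarrow> nat \<Rightarrow> int) \<Rightarrow> (nat \<Rightarrow> nat \<Rightarrow> int) \<Rightarrow> (nat \<Rightarrow> nat \<Rightarrow> int)" where
  "zmat_mult h m r n B C = (\<lambda>i j. if i < m \<and> j < n then (\<Sum>k<r. B i k * C k j) mod int h else 0)"

text \<open>Inner rank: least r with A = B C, B in Z_h^(m x r), C in Z_h^(r x n).
  For A = 0 this gives 0 (empty product), matching rho(0) = 0.\<close>
definition inner_rank :: "nat \<Rightarrow> nat \<Rightarrow> nat \<Rightarrow> (nat \<Rightarrow> nat \<Rightarrow> int) \<Rightarrow> nat" where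
  "inner_rank h m n A = (LEAST r. \<exists>B C. B \<in> zmat h m r \<and> C \<in> zmat h r n \<and> A = zmat_mult h m r n B C)"

definition bil_adj :: "nat \<Rightarrow> nat \<Rightarrow> nat \<Rightarrow> nat \<Rightarrow> (nat \<Rightarrow> nat \<Rightarrow> int) \<Rightarrow> (nat \<Rightarrow> nat \<Rightarrow> int) \<Rightarrow> bool" where
  "bil_adj h m n r A B \<longleftrightarrow> A \<noteq> B \<and> inner_rank h m n (zmat_sub h m n A B) \<le> r"

definition sigma_adj :: "nat \<Rightarrow> nat \<Rightarrow> nat \<Rightarrow> nat \<Rightarrow> (nat \<Rightarrow> nat \<Rightarrow> int) \<Rightarrow> (nat \<Rightarrow> nat \<Rightarrow> int) \<Rightarrow> bool" where
  "sigma_adj h m n r A B \<longleftrightarrow> A \<noteq> B \<and> \<not> bil_adj h m n r A B"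

definition is_clique :: "'a set \<Rightarrow> ('a \<Rightarrow> 'a \<Rightarrow> bool) \<Rightarrow> 'a set \<Rightarrow> bool" where
  "is_clique V E S \<longleftrightarrow> S \<subseteq> V \<and> (\<forall>x\<in>S. \<forall>y\<in>S. x \<noteq> y \<longrightarrow> E x y)"

definition is_indep :: "'a set \<Rightarrow> ('a \<Rightarrow> 'a \<Rightarrow> bool) \<Rightarrow> 'a set \<Rightarrow> bool" where
  "is_indep V E S \<longleftrightarrow> S \<subseteq> V \<and> (\<forall>x\<in>S. \<forall>y\<in>S. \<not> E x y)"

definition clique_number :: "'a set \<Rightarrow> ('a \<Rightarrow> 'a \<Rightarrow> bool) \<Rightarrow> nat" where
  "clique_number V E = Max (card ` {S. is_clique V E S})"

definition indep_number :: "'a set \<Rightarrow> ('a \<Rightarrow> 'a \<Rightarrow> bool) \<Rightarrow> nat" where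
  "indep_number V E = Max (card ` {S. is_indep V E S})"

definition chromatic_number :: "'a set \<Rightarrow> ('a \<Rightarrow> 'a \<Rightarrow> bool) \<Rightarrow> nat" where
  "chromatic_number V E = (LEAST k. \<exists>c. c ` V \<subseteq> {..<k} \<and> (\<forall>x\<in>V. \<forall>y\<in>V. E x y \<longrightarrow> c x \<noteq> c y))"

definition graph_hom :: "'a set \<Rightarrow> ('a \<Rightarrow> 'a \<Rightarrow> bool) \<Rightarrow> 'b set \<Rightarrow> ('b \<Rightarrow> 'b \<Rightarrow> bool) \<Rightarrow> ('a \<Rightarrow> 'b) \<Rightarrow> bool" where
  "graph_hom V1 E1 V2 E2 f \<longleftrightarrow> f ` V1 \<subseteq> V2 \<and> (\<forall>x\<in>V1. \<forall>y\<in>V1. E1 x y \<longrightarrow> E2 (f x) (f y))"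

definition graph_aut :: "'a set \<Rightarrow> ('a \<Rightarrow> 'a \<Rightarrow> bool) \<Rightarrow> ('a \<Rightarrow> 'a) \<Rightarrow> bool" where
  "graph_aut V E f \<longleftrightarrow> bij_betw f V V \<and> (\<forall>x\<in>V. \<forall>y\<in>V. E x y \<longleftrightarrow> E (f x) (f y))"

definition is_core :: "'a set \<Rightarrow> ('a \<Rightarrow> 'a \<Rightarrow> bool) \<Rightarrow> bool" where
  "is_core V E \<longleftrightarrow> (\<forall>f. graph_hom V E V E f \<longrightarrow> graph_aut V E f)"

definition is_subgraph :: "'a set \<Rightarrow> ('a \<Rightarrow> 'a \<Rightarrow> bool) \<Rightarrow> 'a set \<Rightarrow> ('a \<Rightarrow> 'a \<Rightarrow> bool) \<Rightarrow> bool" where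
  "is_subgraph S F V E \<longleftrightarrow> S \<subseteq> V \<and> (\<forall>x y. F x y \<longrightarrow> x \<in> S \<and> y \<in> S \<and> E x y \<and> F y x)"

definition is_core_of :: "'a set \<Rightarrow> ('a \<Rightarrow> 'a \<Rightarrow> bool) \<Rightarrow> 'a set \<Rightarrow> ('a \<Rightarrow> 'a \<Rightarrow> bool) \<Rightarrow> bool" where
  "is_core_of S F V E \<longleftrightarrow> is_subgraph S F V E \<and> is_core S F \<and> (\<exists>f. graph_hom V E S F f)"

end

theory Submission
  imports Defs Complex_Main "HOL-Computational_Algebra.Computational_Algebra"
    "HOL-Number_Theory.Cong" "HOL-Library.FuncSet"
begin

text \<open>Colouring a matrix by its last m - r rows is proper on the complement graph, since two matrices
that agree there differ by a matrix with r nonzero rows. This gives h ^ (n (m - r)) colours, so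
everything follows once the complement graph is shown to have a clique of that size: it is then a
retract of the graph, and the core is such a clique.

The clique consists of the combinations over the residues mod h of n (m - r) integer matrices
which, for every prime p dividing h, reduce to a Gabidulin code over the field with p elements:
every combination with coefficients not all divisible by p has fewer than p ^ (m - r) vectors in
its left kernel mod p. A nonzero codeword A cannot factor as B C with at most r columns in B.
The integer vectors annihilated by B exactly have at least p ^ (m - r) reductions mod p, and they
remain in the left kernel after A and h are divided by their common content, where the coefficients
of A no longer vanish mod some prime p dividing the rest of h.

The field with p ^ n elements needed for the Gabidulin code is taken as the residue field, at a
prime ideal P above p, of the ring R generated by a root of unity of order p ^ n - 1 in the complex
numbers. All computations stay in the complex numbers, modulo P.\<close>

section \<open>Graphs with a colouring and a clique of the same size\<close>

lemma card_clique_le_colours: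
  assumes "finite X" "c ` V \<subseteq> X" "\<And>x y. x \<in> V \<Longrightarrow> y \<in> V \<Longrightarrow> E x y \<Longrightarrow> c x \<noteq> c y"
    and "is_clique V E S"
  shows "card S \<le> card X"
proof (rule card_inj_on_le)
  show "inj_on c S" using assms(3,4) unfolding is_clique_def inj_on_def by blast
  show "c ` S \<subseteq> X" using assms(2,4) unfolding is_clique_def by blast
qed (fact assms(1))

context
  fixes V :: "'a set" and E :: "'a \<Rightarrow> 'a \<Rightarrow> bool" and K :: "'a set" and c :: "'a \<Rightarrow> 'b" and X :: "'b set"
  assumes finite_colours: "finite X" and colours: "c ` V \<subseteq> X"
    and proper: "\<And>x y. x \<in> V \<Longrightarrow> y \<in> V \<Longrightarrow> E x y \<Longrightarrow> c x \<noteq> c y"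
    and clique: "is_clique V E K" and finite_clique: "finite K" and card_clique: "card K = card X"
    and finite_vertices: "finite V" and nonempty: "V \<noteq> {}"
begin

text \<open>Renumbering the colours gives a colouring with \<open>card X = card K\<close> colours,
  and no colouring has fewer since it is injective on \<open>K\<close>.\<close>

lemma chromatic_number_eq_card_clique: "chromatic_number V E = card K"
  unfolding chromatic_number_def
proof (rule Least_equality)
  obtain b where b: "bij_betw b X {..<card X}"
    using ex_bij_betw_finite_nat[OF finite_colours] by (auto simp: atLeast0LessThan)
  have "(b \<circ> c) ` V \<subseteq> {..<card K}"
    using bij_betwE[OF b] colours card_clique by auto
  moreover have "(b \<circ> c) x \<noteq> (b \<circ> c) y" if "x \<in> V" "y \<in> V" "E x y" for x y
    using proper[OF that] bij_betw_imp_inj_on[OF b] colours that by (auto simp: inj_on_def)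
  ultimately show "\<exists>c. c ` V \<subseteq> {..<card K} \<and> (\<forall>x\<in>V. \<forall>y\<in>V. E x y \<longrightarrow> c x \<noteq> c y)"
    by blast
next
  fix k :: nat assume "\<exists>c. c ` V \<subseteq> {..<k} \<and> (\<forall>x\<in>V. \<forall>y\<in>V. E x y \<longrightarrow> c x \<noteq> c y)"
  then obtain c' where "c' ` V \<subseteq> {..<k}" "\<forall>x\<in>V. \<forall>y\<in>V. E x y \<longrightarrow> c' x \<noteq> c' y" by blast
  then show "card K \<le> k"
    using card_clique_le_colours[of "{..<k}" c' V E K] clique by auto
qed

lemma clique_number_eq_card_clique: "clique_number V E = card K"
  unfolding clique_number_def
proof (rule Max_eqI)
  have "{S. is_clique V E S} \<subseteq> Pow V" by (auto simp: is_clique_def)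
  then show "finite (card ` {S. is_clique V E S})"
    using finite_vertices by (meson finite_Pow_iff finite_imageI finite_subset)
  show "y \<le> card K" if "y \<in> card ` {S. is_clique V E S}" for y
    using that card_clique_le_colours[OF finite_colours colours proper] card_clique by auto
  show "card K \<in> card ` {S. is_clique V E S}" using clique by blast
qed

text \<open>A bijection from the colours to \<open>S\<close> turns the colouring into a
  homomorphism. The relation \<open>F\<close> is free because the target is sometimes
  \<open>K\<close> under \<open>E\<close> and sometimes the image of \<open>K\<close> under the
  edges of a core.\<close>

lemma hom_onto_clique:
  assumes "is_clique V F S" "card S = card X" "finite S"
  shows "\<exists>g. graph_hom V E S F g"
proof -
  obtain b where b: "bij_betw b X S"
    using assms finite_colours by (metis finite_same_card_bij)
  have "graph_hom V E S F (b \<circ> c)"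
    unfolding graph_hom_def
  proof (intro conjI ballI impI)
    show "(b \<circ> c) ` V \<subseteq> S" using bij_betwE[OF b] colours by auto
  next
    fix x y assume xy: "x \<in> V" "y \<in> V" "E x y"
    have "b (c x) \<noteq> b (c y)"
      using proper[OF xy] bij_betw_imp_inj_on[OF b] colours xy by (auto simp: inj_on_def)
    moreover have "b (c x) \<in> S" "b (c y) \<in> S"
      using bij_betwE[OF b] colours xy by auto
    ultimately show "F ((b \<circ> c) x) ((b \<circ> c) y)"
      using assms(1) by (auto simp: is_clique_def)
  qed
  then show ?thesis by blast
qed

text \<open>The homomorphism into \<open>K\<close> is an endomorphism of the whole graph that misses
  some vertex.\<close>

lemma not_core_if_clique_smaller:
  assumes "card K < card V"
  shows "\<not> is_core V E"
proof
  assume core: "is_core V E"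
  obtain g where g: "graph_hom V E K E g"
    using hom_onto_clique[OF clique] card_clique finite_clique by blast
  then have "graph_hom V E V E g"
    using clique by (auto simp: graph_hom_def is_clique_def)
  then have "bij_betw g V V" using core by (auto simp: is_core_def graph_aut_def)
  then have "V \<subseteq> K" using g by (auto simp: bij_betw_def graph_hom_def)
  then show False using assms card_mono[OF finite_clique] by (meson not_le)
qed

text \<open>With these edges \<open>K\<close> is a finite complete graph without loops, so its
  endomorphisms are injective and hence bijective.\<close>

lemma clique_is_core:
  assumes irrefl: "\<And>x. \<not> E x x"
  shows "is_core_of K (\<lambda>x y. x \<in> K \<and> y \<in> K \<and> E x y) V E" (is "is_core_of K ?F V E")
proof -
  have F: "?F x y \<longleftrightarrow> x \<in> K \<and> y \<in> K \<and> x \<noteq> y" for x y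
    using clique irrefl unfolding is_clique_def by metis
  have "is_core K ?F"
    unfolding is_core_def
  proof (intro allI impI)
    fix f assume f: "graph_hom K ?F K ?F f"
    then have inj: "inj_on f K" unfolding graph_hom_def inj_on_def F by blast
    moreover have "f ` K \<subseteq> K" using f by (auto simp: graph_hom_def)
    ultimately have "bij_betw f K K"
      using finite_clique by (simp add: bij_betw_def endo_inj_surj)
    then show "graph_aut K ?F f"
      unfolding graph_aut_def F using inj by (auto simp: inj_on_def bij_betw_def)
  qed
  moreover have "is_subgraph K ?F V E"
    using clique unfolding is_subgraph_def is_clique_def by (auto simp: irrefl)
  moreover have "\<exists>g. graph_hom V E K ?F g"
  proof -
    obtain g where "graph_hom V E K E g"
      using hom_onto_clique[OF clique] card_clique finite_clique by blast
    then have "graph_hom V E K ?F g" unfolding graph_hom_def by blast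
    then show ?thesis by blast
  qed
  ultimately show ?thesis unfolding is_core_of_def by blast
qed

text \<open>A core contains an image of the clique K; the colouring retracts the core onto that image.\<close>

lemma core_is_max_clique:
  assumes irrefl: "\<And>x. \<not> E x x" and core: "is_core_of S F V E"
  shows "is_clique V E S" "card S = card K" "F x y \<longleftrightarrow> x \<in> S \<and> y \<in> S \<and> E x y"
proof -
  have sub: "S \<subseteq> V" and FE: "\<And>x y. F x y \<Longrightarrow> x \<in> S \<and> y \<in> S \<and> E x y" 
    using core by (auto simp: is_core_of_def is_subgraph_def)
  obtain f where f: "graph_hom V E S F f" using core by (auto simp: is_core_of_def)
  let ?K = "f ` K"
  have KF: "F (f x) (f y)" if "x \<in> K" "y \<in> K" "x \<noteq> y" for x y
    using that f clique unfolding graph_hom_def is_clique_def by blast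
  have inj: "inj_on f K" using KF FE irrefl unfolding inj_on_def by metis
  have KS: "?K \<subseteq> S" using f clique unfolding graph_hom_def is_clique_def by blast
  have cl: "is_clique V F ?K"
    using KF KS sub inj by (auto simp: is_clique_def inj_on_def)
  obtain g where g: "graph_hom V E ?K F g"
    using hom_onto_clique[OF cl] card_image[OF inj] card_clique finite_clique by auto
  \<comment> \<open>Edges of the core are edges of \<open>E\<close>, so \<open>g\<close> restricts
    to an endomorphism of the core. It must be an automorphism, yet its image lies in
    \<open>?K\<close>; this forces \<open>S = ?K\<close>.\<close>
  have "graph_hom S F S F g"
    using g sub KS FE unfolding graph_hom_def by blast
  then have "bij_betw g S S"
    using core by (auto simp: is_core_of_def is_core_def graph_aut_def)
  then have "g ` S = S" by (simp add: bij_betw_def)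
  moreover have "g ` S \<subseteq> ?K" using g sub unfolding graph_hom_def by blast
  ultimately have S: "S = ?K" using KS by blast
  show "card S = card K" using S card_image[OF inj] by simp
  show "F x y \<longleftrightarrow> x \<in> S \<and> y \<in> S \<and> E x y"
  proof
    assume *: "x \<in> S \<and> y \<in> S \<and> E x y"
    then have "x \<noteq> y" using irrefl by auto
    with * cl S show "F x y" unfolding is_clique_def by blast
  next
    assume "F x y"
    then show "x \<in> S \<and> y \<in> S \<and> E x y" by (rule FE)
  qed
  show "is_clique V E S" using cl S FE sub unfolding is_clique_def by blast
qed

end

section \<open>Left kernels of integer matrices modulo p\<close>

lemma pigeonhole_fibre:
  assumes "finite T" "f ` T \<subseteq> X" "finite X" "X \<noteq> {}"
  obtains x where "x \<in> X" "card T \<le> card X * card {t \<in> T. f t = x}"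
proof (rule ccontr)
  assume no: "\<not> thesis"
  have "T = (\<Union>x\<in>X. {t \<in> T. f t = x})" using assms(2) by auto
  then have "card T \<le> (\<Sum>x\<in>X. card {t \<in> T. f t = x})"
    using card_UN_le[OF assms(3), of "\<lambda>x. {t \<in> T. f t = x}"] by simp
  then have "card X * card T \<le> (\<Sum>x\<in>X. card X * card {t \<in> T. f t = x})"
    by (metis mult_le_mono2 sum_distrib_left)
  also have "\<dots> < (\<Sum>x\<in>X. card T)"
  proof (rule sum_strict_mono)
    show "card X * card {t \<in> T. f t = x} < card T" if "x \<in> X" for x
      using no \<open>x \<in> X\<close> \<open>\<And>x. \<lbrakk>x \<in> X; card T \<le> card X * card {t \<in> T. f t = x}\<rbrakk> \<Longrightarrow> thesis\<close>
      by (meson not_le)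
  qed (fact assms)+
  finally show False by simp
qed

definition mod_vec :: "nat \<Rightarrow> (nat \<Rightarrow> int) \<Rightarrow> nat \<Rightarrow> int" where
  "mod_vec p x = (\<lambda>i. x i mod int p)"

lemma mod_vec_eq_iff: "mod_vec p x = mod_vec p y \<longleftrightarrow> (\<forall>i. int p dvd x i - y i)"
  by (auto simp: mod_vec_def fun_eq_iff mod_eq_dvd_iff)

text \<open>The functional takes values in the multiples of its least positive value e on L. After
pigeonholing representatives by the residue of (functional / e) mod p, the differences can be
corrected by p times an element of L so as to lie in the kernel.\<close>

lemma card_mod_kernel:
  fixes \<phi> :: "(nat \<Rightarrow> int) \<Rightarrow> int"
  assumes p: "p > 0"
    and L: "\<And>x y. x \<in> L \<Longrightarrow> y \<in> L \<Longrightarrow> (\<lambda>i. x i - y i) \<in> L"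
    and L_scale: "\<And>x c. x \<in> L \<Longrightarrow> (\<lambda>i. c * x i) \<in> L"
    and \<phi>: "\<And>x y. \<phi> (\<lambda>i. x i - y i) = \<phi> x - \<phi> y"
    and \<phi>_scale: "\<And>x c. \<phi> (\<lambda>i. c * x i) = c * \<phi> x"
    and fin: "finite (mod_vec p ` L)"
  shows "card (mod_vec p ` L) \<le> p * card (mod_vec p ` {x \<in> L. \<phi> x = 0})"
proof (cases "\<forall>x\<in>L. \<phi> x = 0")
  case True
  then have "{x \<in> L. \<phi> x = 0} = L" by auto
  with p show ?thesis by simp
next
  case False
  then obtain x1 where x1: "x1 \<in> L" "\<phi> x1 \<noteq> 0" by auto
  \<comment> \<open>\<open>Q\<close> picks out the positive values of the functional on
    \<open>L\<close>. There is one, since \<open>x1\<close> may be multiplied by the sign of its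
    value.\<close>
  define Q where "Q k \<longleftrightarrow> k > 0 \<and> (\<exists>x\<in>L. \<phi> x = int k)" for k
  have "\<phi> (\<lambda>i. sgn (\<phi> x1) * x1 i) = int (nat \<bar>\<phi> x1\<bar>)"
    using \<phi>_scale[of "sgn (\<phi> x1)" x1] by (simp add: sgn_mult_self_eq mult.commute flip: abs_sgn)
  then have "Q (nat \<bar>\<phi> x1\<bar>)"
    unfolding Q_def using x1 L_scale[OF x1(1), of "sgn (\<phi> x1)"] by auto
  then have "Q (LEAST k. Q k)" by (rule LeastI)
  then obtain e z where e: "e = (LEAST k. Q k)" "e > 0" "z \<in> L" "\<phi> z = int e"
    unfolding Q_def by blast
  \<comment> \<open>Otherwise the remainder modulo \<open>e\<close> would be a smaller positive
    value, attained at \<open>?y\<close>.\<close>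
  have dvd: "int e dvd \<phi> x" if "x \<in> L" for x
  proof -
    let ?y = "\<lambda>i. x i - (\<phi> x div int e) * z i"
    have y: "?y \<in> L" "\<phi> ?y = \<phi> x mod int e"
      using L[OF that L_scale[OF e(3), of "\<phi> x div int e"]]
        \<phi>[of x "\<lambda>i. (\<phi> x div int e) * z i"] \<phi>_scale[of "\<phi> x div int e" z] e(4)
      by (simp_all add: minus_div_mult_eq_mod)
    have "\<not> Q (nat (\<phi> x mod int e))"
    proof
      assume "Q (nat (\<phi> x mod int e))"
      then have "e \<le> nat (\<phi> x mod int e)" using e(1) Least_le by metis
      then show False using e(2) pos_mod_bound[of "int e" "\<phi> x"] by linarith
    qed
    moreover have "\<phi> x mod int e \<ge> 0" using e(2) by simp
    ultimately have "\<phi> x mod int e = 0" using y unfolding Q_def by force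
    then show ?thesis by auto
  qed
  obtain s where s: "\<And>u. u \<in> mod_vec p ` L \<Longrightarrow> s u \<in> L \<and> mod_vec p (s u) = u"
    using that[of "\<lambda>u. SOME x. x \<in> L \<and> mod_vec p x = u"]
    by (metis (mono_tags, lifting) imageE someI_ex)
  let ?T = "mod_vec p ` L" and ?f = "\<lambda>u. (\<phi> (s u) div int e) mod int p"
  have "?f ` ?T \<subseteq> {0..<int p}" using p by auto
  then obtain w where w: "card ?T \<le> card {0..<int p} * card {u \<in> ?T. ?f u = w}"
    using pigeonhole_fibre[OF fin, of ?f "{0..<int p}"] p by (metis finite_atLeastLessThan_int atLeastLessThan_empty_iff2 of_nat_0_less_iff)
  define A where "A = {u \<in> ?T. ?f u = w}"
  have finA: "finite A" using fin by (simp add: A_def)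
  have "card A \<le> card (mod_vec p ` {x \<in> L. \<phi> x = 0})"
  proof (cases "A = {}")
    case False
    then obtain u0 where u0: "u0 \<in> A" by blast
    let ?g = "\<lambda>u. mod_vec p (\<lambda>i. s u i - s u0 i)"
    have sA: "s u \<in> L" "mod_vec p (s u) = u" "(\<phi> (s u) div int e) mod int p = w" if "u \<in> A" for u
      using that s by (auto simp: A_def)
    have "inj_on ?g A"
    proof
      fix u v assume uv: "u \<in> A" "v \<in> A" "?g u = ?g v"
      have "int p dvd s u i - s v i" for i
      proof -
        have "int p dvd (s u i - s u0 i) - (s v i - s u0 i)"
          using uv(3) unfolding mod_vec_eq_iff by blast
        then show ?thesis by (simp add: algebra_simps)
      qed
      then have "mod_vec p (s u) = mod_vec p (s v)" unfolding mod_vec_eq_iff by blast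
      then show "u = v" using sA uv by metis
    qed
    moreover have "?g ` A \<subseteq> mod_vec p ` {x \<in> L. \<phi> x = 0}"
    proof
      fix v assume "v \<in> ?g ` A"
      then obtain u where u: "u \<in> A" "v = ?g u" by blast
      let ?d = "\<lambda>i. s u i - s u0 i"
      have dL: "?d \<in> L" using L sA u u0 by blast
      have "int p dvd \<phi> (s u) div int e - \<phi> (s u0) div int e"
        using sA(3)[OF u(1)] sA(3)[OF u0] by (metis mod_eq_dvd_iff)
      then obtain t where t: "\<phi> (s u) div int e - \<phi> (s u0) div int e = int p * t" by (elim dvdE)
      have "\<phi> ?d = int e * (\<phi> (s u) div int e - \<phi> (s u0) div int e)"
        using \<phi>[of "s u" "s u0"] dvd[OF sA(1)[OF u(1)]] dvd[OF sA(1)[OF u0]]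
        by (simp add: right_diff_distrib)
      then have \<phi>d: "\<phi> ?d = int p * t * \<phi> z" using t e(4) by simp
      let ?y = "\<lambda>i. ?d i - (int p * t) * z i"
      have "?y \<in> L" using L[OF dL L_scale[OF e(3), of "int p * t"]] .
      moreover have "\<phi> ?y = 0"
        using \<phi>[of ?d "\<lambda>i. (int p * t) * z i"] \<phi>_scale[of "int p * t" z] \<phi>d by simp
      moreover have "mod_vec p ?y = v" unfolding u mod_vec_eq_iff by simp
      ultimately show "v \<in> mod_vec p ` {x \<in> L. \<phi> x = 0}" by blast
    qed
    moreover have "finite (mod_vec p ` {x \<in> L. \<phi> x = 0})"
      using fin by (rule finite_subset[rotated]) auto
    ultimately show ?thesis using card_inj_on_le by blast
  qed auto
  then show ?thesis using w unfolding A_def[symmetric] by (simp add: order_trans)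
qed

text \<open>Canonical representatives of the vectors of length \<open>m\<close> over the field with
  \<open>p\<close> elements; the zero tail makes them unique as functions.\<close>

definition mod_vecs :: "nat \<Rightarrow> nat \<Rightarrow> (nat \<Rightarrow> int) set" where
  "mod_vecs p m = {x. (\<forall>i<m. 0 \<le> x i \<and> x i < int p) \<and> (\<forall>i\<ge>m. x i = 0)}"

lemma card_mod_vecs: "card (mod_vecs p m) = p ^ m" and finite_mod_vecs: "finite (mod_vecs p m)"
proof -
  have b: "bij_betw (\<lambda>x i. if i < m then x i else 0) ({..<m} \<rightarrow>\<^sub>E {0..<int p}) (mod_vecs p m)"
    by (rule bij_betwI[where g = "\<lambda>x. restrict x {..<m}"])
       (auto simp: mod_vecs_def fun_eq_iff PiE_def extensional_def restrict_def Pi_def)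
  show "card (mod_vecs p m) = p ^ m"
    using bij_betw_same_card[OF b] by (simp add: card_PiE)
  show "finite (mod_vecs p m)"
    using bij_betw_finite[OF b] by (simp add: finite_PiE)
qed

text \<open>Each column of \<open>B\<close> is one more functional, and by
  \<open>card_mod_kernel\<close> each costs at most a factor \<open>p\<close>. The kernel is taken
  over the integers and only then reduced mod \<open>p\<close>.\<close>

lemma card_left_kernel_mod:
  fixes B :: "nat \<Rightarrow> nat \<Rightarrow> int" and m :: nat
  assumes p: "p > 0"
  defines "L \<equiv> \<lambda>r. {x. (\<forall>i\<ge>m. x i = 0) \<and> (\<forall>s<r. (\<Sum>i<m. x i * B i s) = 0)}"
  shows "mod_vec p ` L r \<subseteq> mod_vecs p m" "p ^ m \<le> p ^ r * card (mod_vec p ` L r)"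
proof -
  show sub: "mod_vec p ` L r \<subseteq> mod_vecs p m" for r
    using p by (auto simp: L_def mod_vecs_def mod_vec_def)
  show "p ^ m \<le> p ^ r * card (mod_vec p ` L r)"
  proof (induction r)
    case 0
    have "mod_vecs p m \<subseteq> mod_vec p ` L 0"
    proof
      fix x assume x: "x \<in> mod_vecs p m"
      have "x i mod int p = x i" for i
        using x by (cases "i < m") (auto simp: mod_vecs_def)
      then have "mod_vec p x = x" "x \<in> L 0"
        using x by (auto simp: mod_vec_def L_def mod_vecs_def)
      then show "x \<in> mod_vec p ` L 0" by (metis imageI)
    qed
    then show ?case
      using card_mono[of "mod_vec p ` L 0" "mod_vecs p m"] finite_subset[OF sub finite_mod_vecs]
      by (simp add: card_mod_vecs)
  next
    case (Suc r)
    let ?\<phi> = "\<lambda>x. \<Sum>i<m. x i * B i r"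
    have step: "{x \<in> L r. ?\<phi> x = 0} = L (Suc r)"
      by (auto simp: L_def less_Suc_eq)
    have "card (mod_vec p ` L r) \<le> p * card (mod_vec p ` {x \<in> L r. ?\<phi> x = 0})"
    proof (rule card_mod_kernel[OF p])
      show "finite (mod_vec p ` L r)" using finite_subset[OF sub finite_mod_vecs] .
    qed (auto simp: L_def left_diff_distrib sum_subtractf mult.assoc sum_distrib_left[symmetric])
    then have "p ^ r * card (mod_vec p ` L r) \<le> p ^ Suc r * card (mod_vec p ` L (Suc r))"
      unfolding step by (simp add: mult.assoc mult.left_commute)
    with Suc show ?case by linarith
  qed
qed

section \<open>Residue fields and Gabidulin codes\<close>

text \<open>\<open>P\<close> is a prime ideal of the subring \<open>R\<close>, so
  \<open>R / P\<close> is a domain of characteristic \<open>p\<close>. Both are sets in an ambient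
  ring, which lets elements of \<open>R\<close> stand for their classes.\<close>

locale prime_residue =
  fixes R P :: "'a::comm_ring_1 set" and p :: nat
  assumes prime: "prime p"
    and R_one: "1 \<in> R" and R_diff: "x \<in> R \<Longrightarrow> y \<in> R \<Longrightarrow> x - y \<in> R"
    and R_mult: "x \<in> R \<Longrightarrow> y \<in> R \<Longrightarrow> x * y \<in> R"
    and P_subset: "P \<subseteq> R" and P_diff: "x \<in> P \<Longrightarrow> y \<in> P \<Longrightarrow> x - y \<in> P"
    and P_mult: "x \<in> R \<Longrightarrow> y \<in> P \<Longrightarrow> x * y \<in> P"
    and p_in_P: "of_nat p \<in> P" and one_notin_P: "1 \<notin> P"
    and P_prime: "x \<in> R \<Longrightarrow> y \<in> R \<Longrightarrow> x * y \<in> P \<Longrightarrow> x \<in> P \<or> y \<in> P"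
begin

lemma R_zero: "0 \<in> R" using R_diff[OF R_one R_one] by simp
lemma R_minus: "x \<in> R \<Longrightarrow> - x \<in> R" using R_diff[OF R_zero, of x] by simp
lemma R_add: "x \<in> R \<Longrightarrow> y \<in> R \<Longrightarrow> x + y \<in> R" using R_diff[OF _ R_minus, of x y] by simp
lemma R_of_nat: "of_nat k \<in> R" by (induction k) (auto intro: R_zero R_add R_one)
lemma R_of_int: "of_int k \<in> R" by (cases k rule: int_diff_cases) (simp add: R_diff R_of_nat)
lemma R_power: "x \<in> R \<Longrightarrow> x ^ k \<in> R" by (induction k) (auto intro: R_one R_mult)
lemma R_sum: "(\<And>i. i \<in> A \<Longrightarrow> f i \<in> R) \<Longrightarrow> sum f A \<in> R"
  by (induction A rule: infinite_finite_induct) (auto intro: R_zero R_add)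

lemmas R_intros = R_one R_zero R_diff R_add R_mult R_of_nat R_of_int R_power R_sum

lemma P_zero: "0 \<in> P" using P_diff[OF p_in_P p_in_P] by simp
lemma P_minus: "x \<in> P \<Longrightarrow> - x \<in> P" using P_diff[OF P_zero, of x] by simp
lemma P_add: "x \<in> P \<Longrightarrow> y \<in> P \<Longrightarrow> x + y \<in> P" using P_diff[OF _ P_minus, of x y] by simp
lemma P_sum: "(\<And>i. i \<in> A \<Longrightarrow> f i \<in> P) \<Longrightarrow> sum f A \<in> P"
  by (induction A rule: infinite_finite_induct) (auto intro: P_zero P_add)

lemma P_of_int: "int p dvd k \<Longrightarrow> of_int k \<in> P"
  using P_mult[OF R_of_int p_in_P] by (auto elim!: dvdE simp: mult.commute)

section \<open>Congruence modulo P\<close>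

definition eqv :: "'a \<Rightarrow> 'a \<Rightarrow> bool" (infix "\<simeq>" 50) where "x \<simeq> y \<longleftrightarrow> x - y \<in> P"

lemma eqv_refl: "x \<simeq> x" by (simp add: eqv_def P_zero)
lemma eqv_sym: "x \<simeq> y \<Longrightarrow> y \<simeq> x" using P_minus unfolding eqv_def by fastforce
lemma eqv_trans [trans]: "x \<simeq> y \<Longrightarrow> y \<simeq> z \<Longrightarrow> x \<simeq> z"
  using P_add[of "x - y" "y - z"] unfolding eqv_def by simp
lemma eqv_add: "x \<simeq> y \<Longrightarrow> x' \<simeq> y' \<Longrightarrow> x + x' \<simeq> y + y'"
  using P_add[of "x - y" "x' - y'"] unfolding eqv_def by (simp add: algebra_simps)
lemma eqv_sum: "(\<And>i. i \<in> A \<Longrightarrow> f i \<simeq> g i) \<Longrightarrow> sum f A \<simeq> sum g A"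
  using P_sum[of A "\<lambda>i. f i - g i"] unfolding eqv_def by (simp add: sum_subtractf)
lemma eqv_mult:
  assumes "x \<simeq> y" "x' \<simeq> y'" "x \<in> R" "y' \<in> R"
  shows "x * x' \<simeq> y * y'"
proof -
  have "x * (x' - y') + y' * (x - y) \<in> P" using assms unfolding eqv_def by (intro P_add P_mult)
  then show ?thesis unfolding eqv_def by (simp add: algebra_simps)
qed
lemma eqv_power: "x \<simeq> y \<Longrightarrow> x \<in> R \<Longrightarrow> y \<in> R \<Longrightarrow> x ^ k \<simeq> y ^ k"
  by (induction k) (auto intro: eqv_mult eqv_refl R_power)
lemma eqv_in_P: "x \<simeq> y \<Longrightarrow> x \<in> P \<longleftrightarrow> y \<in> P"
  using P_add[of "x - y" y] P_diff[of x "x - y"] unfolding eqv_def by auto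
lemma eqv_of_int: "int p dvd a - b \<Longrightarrow> of_int a \<simeq> of_int b"
  using P_of_int[of "a - b"] unfolding eqv_def by simp

section \<open>The Frobenius map modulo P\<close>

lemma p_pos: "p > 0" using prime by (rule prime_gt_0_nat)

lemma frobenius_add:
  assumes "x \<in> R" "y \<in> R"
  shows "(x + y) ^ p \<simeq> x ^ p + y ^ p"
proof -
  let ?f = "\<lambda>k. of_nat (p choose k) * x ^ k * y ^ (p - k)"
  have "{..p} = {0, p} \<union> {1..<p}" by auto
  then have "(x + y) ^ p = sum ?f {0, p} + sum ?f {1..<p}"
    unfolding binomial_ring by (simp only:) (rule sum.union_disjoint; auto)
  moreover have "sum ?f {0, p} = x ^ p + y ^ p" using p_pos by simp
  \<comment> \<open>The inner binomial coefficients are divisible by \<open>p\<close>.\<close>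
  moreover have "sum ?f {1..<p} \<in> P"
  proof (rule P_sum)
    fix k assume k: "k \<in> {1..<p}"
    then have "p dvd (p choose k)" using prime by (intro dvd_choose_prime) auto
    then have "of_int (int (p choose k)) \<in> P" by (intro P_of_int) simp
    then have "(x ^ k * y ^ (p - k)) * of_nat (p choose k) \<in> P"
      using assms by (intro P_mult R_intros) auto
    then show "?f k \<in> P" by (simp add: mult_ac)
  qed
  ultimately show ?thesis unfolding eqv_def by simp
qed

text \<open>Fermat's little theorem, by induction with \<open>frobenius_add\<close>.\<close>

lemma frobenius_of_nat: "of_nat a ^ p \<simeq> (of_nat a :: 'a)"
proof (induction a)
  case 0
  then show ?case using p_pos by (simp add: eqv_refl zero_power)
next
  case (Suc a)
  have "(of_nat (Suc a) :: 'a) ^ p = (of_nat a + 1) ^ p" by (simp add: add.commute)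
  also have "(of_nat a + 1) ^ p \<simeq> of_nat a ^ p + (1::'a) ^ p" by (intro frobenius_add R_intros)
  also have "\<dots> \<simeq> of_nat a + 1" using eqv_add[OF Suc eqv_refl, of 1] by simp
  finally show ?case by (simp add: add.commute)
qed

lemma frobenius_of_int: "of_int a ^ p \<simeq> (of_int a :: 'a)"
proof -
  let ?b = "of_int (a mod int p) :: 'a"
  have b: "(of_int a :: 'a) \<simeq> ?b" by (rule eqv_of_int) (simp add: minus_mod_eq_mult_div)
  have "?b = of_nat (nat (a mod int p))" using p_pos by simp
  then have "?b ^ p \<simeq> ?b" using frobenius_of_nat by metis
  then show ?thesis using eqv_power[OF b, of p] b eqv_trans eqv_sym R_of_int by meson
qed

text \<open>Modulo \<open>P\<close> the Frobenius map is additive and fixes integers, so its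
  iterates are linear over the prime field.\<close>

lemma frobenius_sum:
  assumes "\<And>i. i \<in> A \<Longrightarrow> e i \<in> R"
  shows "(\<Sum>i\<in>A. of_int (a i) * e i) ^ p ^ j \<simeq> (\<Sum>i\<in>A. of_int (a i) * e i ^ p ^ j)"
proof -
  \<comment> \<open>A single application, for arbitrary \<open>e\<close>, because the iteration
    below uses it for the powers \<open>e i ^ p ^ j\<close>.\<close>
  have one: "(\<Sum>i\<in>A. of_int (a i) * e i) ^ p \<simeq> (\<Sum>i\<in>A. of_int (a i) * e i ^ p)"
    if "\<And>i. i \<in> A \<Longrightarrow> e i \<in> R" for e :: "'b \<Rightarrow> 'a"
    using that
  proof (induction A rule: infinite_finite_induct)
    case (insert x A)
    have "(\<Sum>i\<in>insert x A. of_int (a i) * e i) ^ p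
        = (of_int (a x) * e x + (\<Sum>i\<in>A. of_int (a i) * e i)) ^ p"
      using insert by simp
    also have "\<dots> \<simeq> (of_int (a x) * e x) ^ p + (\<Sum>i\<in>A. of_int (a i) * e i) ^ p"
      using insert by (intro frobenius_add R_intros) auto
    also have "\<dots> \<simeq> of_int (a x) * e x ^ p + (\<Sum>i\<in>A. of_int (a i) * e i ^ p)"
      unfolding power_mult_distrib
      using insert by (intro eqv_add eqv_mult frobenius_of_int eqv_refl insert.IH R_intros) auto
    finally show ?case using insert by simp
  qed (use p_pos in \<open>simp_all add: eqv_refl zero_power\<close>)
  show ?thesis
  proof (induction j)
    case (Suc j)
    have "(\<Sum>i\<in>A. of_int (a i) * e i) ^ p ^ Suc j = ((\<Sum>i\<in>A. of_int (a i) * e i) ^ p ^ j) ^ p"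
      by (simp flip: power_mult add: mult.commute)
    also have "\<dots> \<simeq> (\<Sum>i\<in>A. of_int (a i) * e i ^ p ^ j) ^ p"
      using assms by (intro eqv_power Suc R_intros) auto
    also have "\<dots> \<simeq> (\<Sum>i\<in>A. of_int (a i) * (e i ^ p ^ j) ^ p)"
      using assms by (intro one R_intros) auto
    finally show ?case by (simp flip: power_mult add: mult.commute)
  qed (simp add: eqv_refl)
qed

section \<open>Roots of polynomials modulo P\<close>

lemma poly_in_R: "(\<And>i. coeff f i \<in> R) \<Longrightarrow> x \<in> R \<Longrightarrow> poly f x \<in> R"
  unfolding poly_altdef by (intro R_intros) auto

text \<open>Splitting off a root needs no division: the coefficients of the quotient are values at
  \<open>a\<close> of tails of \<open>f\<close>.\<close>

lemma coeff_synthetic_div_in_R: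
  "(\<And>i. coeff f i \<in> R) \<Longrightarrow> a \<in> R \<Longrightarrow> coeff (synthetic_div f a) i \<in> R"
proof (induction f arbitrary: i)
  case (pCons c q)
  have q: "coeff q i \<in> R" for i using pCons.prems(1)[of "Suc i"] by simp
  show ?case
    using pCons.IH[OF q pCons.prems(2)] poly_in_R[OF q pCons.prems(2)]
    by (cases i) simp_all
qed (simp add: R_zero)

text \<open>The usual root count over the domain \<open>R / P\<close>, by splitting off one root at
  a time. Distinct roots are incongruent elements, and a nonzero polynomial is one with a
  coefficient outside \<open>P\<close>.\<close>

lemma card_roots_le:
  assumes "\<And>i. coeff f i \<in> R" "degree f \<le> D" "\<exists>i. coeff f i \<notin> P"
    and "finite S" "S \<subseteq> R" "\<And>s. s \<in> S \<Longrightarrow> poly f s \<in> P"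
    and "\<And>s t. s \<in> S \<Longrightarrow> t \<in> S \<Longrightarrow> s \<simeq> t \<Longrightarrow> s = t"
  shows "card S \<le> D"
  using assms
proof (induction D arbitrary: f S)
  case 0
  obtain c where "f = [:c:]" using 0(2) degree_eq_zeroE by auto
  moreover have "c \<notin> P" using 0(3) calculation P_zero
    by (metis coeff_pCons_0 coeff_pCons_Suc coeff_0 not0_implies_Suc)
  ultimately have "S = {}" using 0(6) by auto
  then show ?case by simp
next
  case (Suc D)
  show ?case
  proof (cases "S = {}")
    case False
    then obtain a where a: "a \<in> S" by blast
    let ?g = "synthetic_div f a"
    have aR: "a \<in> R" using a Suc.prems by auto
    have gR: "coeff ?g i \<in> R" for i using coeff_synthetic_div_in_R[OF Suc.prems(1) aR] .
    have f: "f = pCons (poly f a) ?g - smult a ?g"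
      using synthetic_div_correct[of f a] by (simp add: algebra_simps)
    \<comment> \<open>Modulo \<open>P\<close>, \<open>f\<close> is \<open>?g\<close> times X - a, so
      \<open>?g\<close> cannot vanish there unless \<open>f\<close> does.\<close>
    have gP: "\<exists>i. coeff ?g i \<notin> P"
    proof (rule ccontr)
      assume "\<not> ?thesis"
      then have "coeff (pCons (poly f a) ?g) i - a * coeff ?g i \<in> P" for i
        using Suc.prems(6)[OF a] aR
        by (cases i) (auto simp: intro!: P_diff P_mult)
      then have "coeff f i \<in> P" for i using f by (metis coeff_diff coeff_smult)
      then show False using Suc.prems(3) by blast
    qed
    have "card (S - {a}) \<le> D"
    proof (rule Suc.IH[OF gR _ gP])
      show "degree ?g \<le> D" using Suc.prems(2) by (simp add: degree_synthetic_div)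
      show "poly ?g b \<in> P" if b: "b \<in> S - {a}" for b
      proof -
        have "poly f b = poly f a + (b - a) * poly ?g b"
          using arg_cong[OF f, of "\<lambda>f. poly f b"] by (simp add: algebra_simps)
        then have "(b - a) * poly ?g b \<in> P"
          using P_diff[OF Suc.prems(6)[of b] Suc.prems(6)[OF a]] b by simp
        moreover have "b - a \<notin> P"
          using Suc.prems(7)[of b a] a b unfolding eqv_def by blast
        moreover have "b \<in> R" using b Suc.prems by auto
        ultimately show ?thesis using P_prime poly_in_R[OF gR] R_diff aR by blast
      qed
    qed (use Suc.prems in auto)
    then show ?thesis using Suc.prems(4) a by (simp add: card_Diff_singleton_if)
  qed simp
qed

text \<open>Linear independence over the prime field of the classes of \<open>e 0\<close>, ...,
  \<open>e (k - 1)\<close> in \<open>R / P\<close>, with integers as coefficients.\<close>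

definition independent :: "(nat \<Rightarrow> 'a) \<Rightarrow> nat \<Rightarrow> bool" where
  "independent e k \<longleftrightarrow>
     (\<forall>a :: nat \<Rightarrow> int. (\<Sum>i<k. of_int (a i) * e i) \<in> P \<longrightarrow> (\<forall>i<k. int p dvd a i))"

lemma independent_mod_vecs_eqD:
  assumes "independent e n" "k \<le> n" "x \<in> mod_vecs p k" "y \<in> mod_vecs p k"
    "(\<Sum>i<k. of_int (x i) * e i) \<simeq> (\<Sum>i<k. of_int (y i) * e i)"
  shows "x = y"
proof
  fix i
  have z: "x i = 0" "y i = 0" if "i \<ge> k" for i
    using assms that by (auto simp: mod_vecs_def)
  have "(\<Sum>i<n. of_int (x i - y i) * e i) = (\<Sum>i<k. of_int (x i - y i) * e i)"
    using assms(2) z by (intro sum.mono_neutral_right) auto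
  also have "\<dots> = (\<Sum>i<k. of_int (x i) * e i) - (\<Sum>i<k. of_int (y i) * e i)"
    by (simp add: left_diff_distrib sum_subtractf)
  finally have "\<forall>i<n. int p dvd x i - y i"
    using assms(1,5) unfolding independent_def eqv_def by metis
  then have "x i mod int p = y i mod int p" if "i < k"
    using assms(2) that by (simp add: mod_eq_dvd_iff)
  then show "x i = y i" using assms z by (cases "i < k") (auto simp: mod_vecs_def)
qed

lemma combination_reduce:
  fixes e :: "nat \<Rightarrow> 'a"
  assumes "\<And>i. e i \<in> R"
  shows "\<exists>b\<in>mod_vecs p k. (\<Sum>i<k. of_int (a i) * e i) \<simeq> (\<Sum>i<k. of_int (b i) * e i)"
proof
  let ?b = "\<lambda>i. if i < k then a i mod int p else 0"
  show "?b \<in> mod_vecs p k" using p_pos by (auto simp: mod_vecs_def)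
  show "(\<Sum>i<k. of_int (a i) * e i) \<simeq> (\<Sum>i<k. of_int (?b i) * e i)"
    using assms by (intro eqv_sum eqv_mult eqv_of_int eqv_refl R_intros)
      (auto simp: minus_mod_eq_mult_div)
qed

end

text \<open>These assumptions make R / P the field with p ^ n elements, with T a set of representatives.\<close>

locale finite_prime_residue = prime_residue R P p
  for R P :: "'a::comm_ring_1 set" and p :: nat +
  fixes n :: nat and T :: "'a set"
  assumes n_pos: "n > 0"
    and frobenius_fixed: "x \<in> R \<Longrightarrow> x ^ p ^ n - x \<in> P"
    and T_subset: "T \<subseteq> R" and card_T: "card T = p ^ n"
    and T_incongruent: "x \<in> T \<Longrightarrow> y \<in> T \<Longrightarrow> x - y \<in> P \<Longrightarrow> x = y"
begin

text \<open>For \<open>k < n\<close> the \<open>p ^ k\<close> combinations of \<open>k\<close>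
  elements cannot represent all \<open>p ^ n\<close> incongruent elements of \<open>T\<close>, so
  some \<open>t\<close> outside their span can be appended.\<close>

lemma exists_independent: "k \<le> n \<Longrightarrow> \<exists>e. (\<forall>i. e i \<in> R) \<and> independent e k"
proof (induction k)
  case 0
  show ?case by (rule exI[of _ "\<lambda>_. 0"]) (auto simp: independent_def R_zero)
next
  case (Suc k)
  then obtain e where e: "\<And>i. e i \<in> R" "independent e k" by auto
  let ?c = "\<lambda>a. \<Sum>i<k. of_int (a i) * e i"
  have "\<exists>t\<in>T. \<forall>a\<in>mod_vecs p k. \<not> t \<simeq> ?c a"
  proof (rule ccontr)
    assume "\<not> ?thesis"
    then obtain f where f: "\<And>t. t \<in> T \<Longrightarrow> f t \<in> mod_vecs p k \<and> t \<simeq> ?c (f t)" by metis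
    have "inj_on f T"
    proof
      fix t t' assume "t \<in> T" "t' \<in> T" "f t = f t'"
      then have "t \<simeq> t'" using f eqv_trans eqv_sym by metis
      then show "t = t'" using T_incongruent \<open>t \<in> T\<close> \<open>t' \<in> T\<close> by (simp add: eqv_def)
    qed
    then have "card T \<le> card (mod_vecs p k)"
      using f finite_mod_vecs by (intro card_inj_on_le[of f]) auto
    then show False
      using Suc.prems prime_gt_1_nat[OF prime] by (simp add: card_T card_mod_vecs)
  qed
  then obtain t where t: "t \<in> T" "\<And>a. a \<in> mod_vecs p k \<Longrightarrow> \<not> t \<simeq> ?c a" by blast
  have tR: "t \<in> R" using t T_subset by blast
  have t': "\<not> t \<simeq> ?c a" for a
    using combination_reduce[of e k a, OF e(1)] t eqv_trans by blast
  let ?e = "e(k := t)"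
  have "independent ?e (Suc k)"
    unfolding independent_def
  proof (intro allI impI)
    fix a :: "nat \<Rightarrow> int" and i
    assume "(\<Sum>i<Suc k. of_int (a i) * ?e i) \<in> P" and i: "i < Suc k"
    then have *: "?c a + of_int (a k) * t \<in> P" by simp
    \<comment> \<open>If \<open>p\<close> did not divide the coefficient of \<open>t\<close>, its
      inverse \<open>u\<close> mod \<open>p\<close> would express \<open>t\<close> through the
      earlier elements.\<close>
    have ak: "int p dvd a k"
    proof (rule ccontr)
      assume "\<not> int p dvd a k"
      then have "coprime (a k) (int p)"
        using prime by (metis coprime_commute prime_imp_coprime prime_nat_int_transfer)
      then obtain u where u: "[a k * u = 1] (mod int p)" using cong_solve_coprime_int by blast
      then have "int p dvd u * a k - 1" by (simp add: cong_iff_dvd_diff mult.commute)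
      then have "of_int (u * a k) * t \<simeq> of_int 1 * t"
        using tR by (intro eqv_mult eqv_of_int eqv_refl R_intros)
      then have "of_int u * (of_int (a k) * t) - t \<in> P" by (simp add: eqv_def mult.assoc)
      moreover have "of_int u * (?c a + of_int (a k) * t) \<in> P"
        using P_mult[OF R_of_int *] .
      ultimately have "of_int u * (?c a + of_int (a k) * t)
          - (of_int u * (of_int (a k) * t) - t) \<in> P" by (rule P_diff[rotated])
      then have "t - ?c (\<lambda>i. - u * a i) \<in> P"
        by (simp add: distrib_left sum_distrib_left sum_negf mult.assoc add.commute)
      then show False using t'[of "\<lambda>i. - u * a i"] unfolding eqv_def by contradiction
    qed
    then have "of_int (a k) * t \<in> P" using P_mult[OF tR P_of_int] by (simp add: mult.commute)
    then have "?c a \<in> P" using P_diff[OF *] by fastforce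
    then show "int p dvd a i" using e(2) ak i unfolding independent_def by (auto simp: less_Suc_eq)
  qed
  moreover have "\<forall>i. ?e i \<in> R" using e tR by simp
  ultimately show ?case by blast
qed

text \<open>Every element of \<open>R\<close> is a root of X ^ q - X modulo \<open>P\<close>, where
  q is \<open>p ^ n\<close>. The combinations are already q incongruent roots, so an
  \<open>x\<close> outside their span would be one too many.\<close>

lemma independent_spans:
  assumes e: "\<And>i. e i \<in> R" "independent e n" and x: "x \<in> R"
  shows "\<exists>c :: nat \<Rightarrow> int. x \<simeq> (\<Sum>i<n. of_int (c i) * e i)"
proof (rule ccontr)
  assume no: "\<not> ?thesis"
  let ?c = "\<lambda>a :: nat \<Rightarrow> int. \<Sum>i<n. of_int (a i) * e i" and ?q = "p ^ n"
  let ?S = "insert x (?c ` mod_vecs p n)" and ?f = "monom 1 ?q - monom 1 1 :: 'a poly"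
  have q: "?q > 1" by (rule one_less_power[OF prime_gt_1_nat[OF prime] n_pos])
  have "coeff ?f i \<in> {0, 1, -1}" for i using q by auto
  then have 1: "coeff ?f i \<in> R" for i
    by (metis R_minus R_one R_zero empty_iff insert_iff)
  have "coeff ?f ?q = 1" using q by simp
  then have 2: "\<exists>i. coeff ?f i \<notin> P" using one_notin_P by metis
  have "degree ?f \<le> ?q" using q by (intro degree_diff_le degree_monom_le order_trans[OF degree_monom_le]) auto
  moreover have "?S \<subseteq> R" using x e by (auto intro!: R_intros)
  ultimately have "card ?S \<le> ?q"
  proof (intro card_roots_le[OF 1 _ 2])
    show "poly ?f s \<in> P" if "s \<in> ?S" for s
      using frobenius_fixed[of s] that \<open>?S \<subseteq> R\<close> by (auto simp: poly_monom)
    show "s = t" if "s \<in> ?S" "t \<in> ?S" "s \<simeq> t" for s t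
      using that no eqv_sym independent_mod_vecs_eqD[OF e(2) order_refl] by blast
  qed (auto simp: finite_mod_vecs)
  moreover have "card (?c ` mod_vecs p n) = ?q"
  proof (subst card_image)
    show "inj_on ?c (mod_vecs p n)"
      using independent_mod_vecs_eqD[OF e(2) order_refl] eqv_refl unfolding inj_on_def by metis
  qed (rule card_mod_vecs)
  moreover have "x \<notin> ?c ` mod_vecs p n" using no eqv_refl by blast
  ultimately show False by (simp add: finite_mod_vecs)
qed

text \<open>Row i of the codeword with coefficients a is the coordinate vector of the value at e i of the
linearized polynomial with coefficients (sum of a (j, l) * e l over l) at X ^ (p ^ j); a vector x
in the left kernel yields the root (sum of x i * e i), and there are at most p ^ (d - 1) roots.\<close>

lemma exists_gabidulin_code:
  assumes "m \<le> n"
  shows "\<exists>G :: nat \<times> nat \<Rightarrow> nat \<Rightarrow> nat \<Rightarrow> int. \<forall>a :: nat \<times> nat \<Rightarrow> int.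
    (\<exists>k\<in>{..<d} \<times> {..<n}. \<not> int p dvd a k) \<longrightarrow>
    card {x \<in> mod_vecs p m. \<forall>c<n. int p dvd (\<Sum>i<m. x i * (\<Sum>k\<in>{..<d} \<times> {..<n}. a k * G k i c))} < p ^ d"
proof -
  obtain e where e: "\<And>i. e i \<in> R" "independent e n" using exists_independent[of n] by auto
  define coord where "coord x = (SOME c. x \<simeq> (\<Sum>i<n. of_int (c i) * e i))" for x
  have coord: "x \<simeq> (\<Sum>i<n. of_int (coord x i) * e i)" if "x \<in> R" for x
    unfolding coord_def by (rule someI_ex[OF independent_spans[OF e that]])
  define G where "G k i = coord (e (snd k) * e i ^ p ^ fst k)" for k :: "nat \<times> nat" and i
  let ?I = "{..<d} \<times> {..<n}"
  have "card {x \<in> mod_vecs p m. \<forall>c<n. int p dvd (\<Sum>i<m. x i * (\<Sum>k\<in>?I. a k * G k i c))} < p ^ d"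
    if a: "\<exists>k\<in>?I. \<not> int p dvd a k" for a
  proof -
    let ?X = "{x \<in> mod_vecs p m. \<forall>c<n. int p dvd (\<Sum>i<m. x i * (\<Sum>k\<in>?I. a k * G k i c))}"
    let ?y = "\<lambda>x :: nat \<Rightarrow> int. \<Sum>i<m. of_int (x i) * e i"
    define w where "w j = (\<Sum>l<n. of_int (a (j, l)) * e l)" for j
    define f where "f = (\<Sum>j<d. monom (w j) (p ^ j))"
    have wR: "w j \<in> R" for j using e by (auto simp: w_def intro!: R_intros)
    \<comment> \<open>The exponents \<open>p ^ j\<close> are distinct, so the terms of
      \<open>f\<close> cannot cancel each other.\<close>
    have inj_p: "p ^ i = p ^ j \<longleftrightarrow> i = j" for i j
      using prime_gt_1_nat[OF prime] by simp
    have fR: "coeff f i \<in> R" for i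
      unfolding f_def coeff_sum by (rule R_sum) (simp add: wR R_zero)
    obtain j0 l0 where jl: "j0 < d" "l0 < n" "\<not> int p dvd a (j0, l0)" using a by auto
    have "w j0 \<notin> P"
      using e(2)[unfolded independent_def, rule_format, of "\<lambda>l. a (j0, l)" l0] jl
      unfolding w_def by blast
    moreover have "coeff f (p ^ j0) = w j0"
      using jl(1) by (simp add: f_def coeff_sum inj_p)
    ultimately have fP: "\<exists>i. coeff f i \<notin> P" by metis
    have deg: "degree f \<le> p ^ (d - 1)"
      unfolding f_def
    proof (rule degree_sum_le)
      fix j assume "j \<in> {..<d}"
      then have "p ^ j \<le> p ^ (d - 1)" using p_pos by (intro power_increasing) auto
      then show "degree (monom (w j) (p ^ j)) \<le> p ^ (d - 1)"
        using degree_monom_le order_trans by blast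
    qed simp
    have poly_f: "poly f y = (\<Sum>k\<in>?I. of_int (a k) * (e (snd k) * y ^ p ^ fst k))" for y
      by (simp add: f_def poly_sum poly_monom w_def sum_distrib_right mult.assoc sum.cartesian_product split_def)
    \<comment> \<open>Linearity of the Frobenius powers turns the value of \<open>f\<close> at
      \<open>?y x\<close> into the combination of its values at the \<open>e i\<close>. In
      coordinates this is \<open>x\<close> times the codeword, whose entries are divisible by
      \<open>p\<close>.\<close>
    have root: "poly f (?y x) \<in> P" if x: "x \<in> ?X" for x
    proof -
      have "poly f (?y x)
          \<simeq> (\<Sum>k\<in>?I. of_int (a k) * (e (snd k) * (\<Sum>i<m. of_int (x i) * e i ^ p ^ fst k)))"
        unfolding poly_f
        by (intro eqv_sum eqv_mult eqv_refl frobenius_sum R_intros e)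
      also have "\<dots> = (\<Sum>k\<in>?I. \<Sum>i<m. of_int (a k * x i) * (e (snd k) * e i ^ p ^ fst k))"
        by (simp add: sum_distrib_left mult_ac)
      also have "\<dots> \<simeq> (\<Sum>k\<in>?I. \<Sum>i<m. of_int (a k * x i) * (\<Sum>c<n. of_int (G k i c) * e c))"
        unfolding G_def
        by (intro eqv_sum eqv_mult eqv_refl coord R_intros e)
      also have "\<dots> = (\<Sum>k\<in>?I. \<Sum>i<m. \<Sum>c<n. of_int (x i * (a k * G k i c)) * e c)"
        by (simp add: sum_distrib_left mult_ac)
      also have "\<dots> = (\<Sum>i<m. \<Sum>k\<in>?I. \<Sum>c<n. of_int (x i * (a k * G k i c)) * e c)"
        by (rule sum.swap)
      also have "\<dots> = (\<Sum>i<m. \<Sum>c<n. \<Sum>k\<in>?I. of_int (x i * (a k * G k i c)) * e c)"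
        by (rule sum.cong[OF refl], rule sum.swap)
      also have "\<dots> = (\<Sum>c<n. \<Sum>i<m. \<Sum>k\<in>?I. of_int (x i * (a k * G k i c)) * e c)"
        by (rule sum.swap)
      also have "\<dots> = (\<Sum>c<n. e c * of_int (\<Sum>i<m. x i * (\<Sum>k\<in>?I. a k * G k i c)))"
        by (simp add: sum_distrib_left mult_ac)
      finally have eqv: "poly f (?y x) \<simeq> \<dots>" .
      have "(\<Sum>c<n. e c * of_int (\<Sum>i<m. x i * (\<Sum>k\<in>?I. a k * G k i c))) \<in> P"
        using x by (intro P_sum P_mult P_of_int e(1)) simp
      then show ?thesis unfolding eqv_in_P[OF eqv] .
    qed
    have y_inj: "x = x'" if "x \<in> ?X" "x' \<in> ?X" "?y x \<simeq> ?y x'" for x x'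
      using independent_mod_vecs_eqD[OF e(2) assms, of x x'] that by blast
    have "card (?y ` ?X) \<le> p ^ (d - 1)"
    proof (rule card_roots_le[OF fR deg fP])
      show "finite (?y ` ?X)" using finite_mod_vecs by simp
      show "?y ` ?X \<subseteq> R" using e by (auto intro!: R_intros)
    qed (use root y_inj in blast)+
    moreover have "card (?y ` ?X) = card ?X"
    proof (intro card_image inj_onI)
      fix x x' assume xx': "x \<in> ?X" "x' \<in> ?X" "?y x = ?y x'"
      show "x = x'" using y_inj[OF xx'(1,2)] eqv_refl xx'(3) by simp
    qed
    \<comment> \<open>Strict because \<open>j0 < d\<close> makes \<open>d\<close> positive.\<close>
    moreover have "p ^ (d - 1) < p ^ d"
      using jl(1) prime_gt_1_nat[OF prime] by (simp add: power_strict_increasing)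
    ultimately show ?thesis by linarith
  qed
  then show ?thesis by blast
qed

end

section \<open>Residue fields of cyclotomic rings\<close>

text \<open>Nakayama: if M = p M for the span M of e 0, ..., e (N - 1), then successively eliminating
generators yields an integer d prime to p with d M = 0.\<close>

lemma int_span_not_p_divisible:
  fixes e :: "nat \<Rightarrow> 'a::{idom, ring_char_0}" and p :: nat
  assumes p: "prime p" and N: "N > 0" and e0: "e 0 \<noteq> 0"
  shows "\<exists>i<N. \<forall>c :: nat \<Rightarrow> int. e i \<noteq> of_nat p * (\<Sum>j<N. of_int (c j) * e j)"
proof (rule ccontr)
  assume "\<not> ?thesis"
  then obtain c :: "nat \<Rightarrow> nat \<Rightarrow> int"
    where c: "\<And>i. i < N \<Longrightarrow> e i = of_nat p * (\<Sum>j<N. of_int (c i j) * e j)" by metis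
  \<comment> \<open>The state of the elimination: after multiplication by an integer prime to
    \<open>p\<close>, all generators lie in the span of the first \<open>k\<close>. It descends from
    \<open>N\<close> to 0.\<close>
  define Q where "Q k \<longleftrightarrow> (\<exists>d :: int. \<not> int p dvd d \<and>
      (\<forall>i<N. \<exists>a :: nat \<Rightarrow> int. of_int d * e i = (\<Sum>j<k. of_int (a j) * e j)))" for k
  have "Q (N - k)" for k
  proof (induction k)
    case 0
    have "\<exists>a :: nat \<Rightarrow> int. e i = (\<Sum>j<N. of_int (a j) * e j)" if "i < N" for i
      using that by (intro exI[of _ "\<lambda>j. if j = i then 1 else 0"])
        (simp add: of_int_of_bool sum.If_cases if_distrib[of of_int] if_distrib[of "\<lambda>x. x * _"] sum.delta cong: if_cong)
    moreover have "\<not> int p dvd 1" using prime_gt_1_nat[OF p] by simp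
    ultimately show ?case unfolding Q_def by (intro exI[of _ 1]) simp
  next
    case (Suc k)
    show ?case
    proof (cases "k < N")
      case True
      define r where "r = N - Suc k"
      have r: "N - k = Suc r" "N - Suc k = r" "r < N" using True by (auto simp: r_def)
      from Suc obtain d a where d: "\<not> int p dvd d"
        and a: "\<And>i. i < N \<Longrightarrow> of_int d * e i = (\<Sum>j<Suc r. of_int (a i j) * e j)"
        unfolding Q_def r by metis
      define b where "b j = (\<Sum>i<N. c r i * a i j)" for j
      \<comment> \<open>The relation \<open>c r\<close> writes \<open>d\<close> times
        \<open>e r\<close> as \<open>p\<close> times a combination of the \<open>e j\<close> with
        \<open>j\<close> up to \<open>r\<close>; moving the \<open>e r\<close> term to the left
        leaves the coefficient \<open>u\<close>, which is still prime to \<open>p\<close>.\<close>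
      define u where "u = d - int p * b r"
      have "of_int d * e r = of_nat p * (\<Sum>i<N. of_int (c r i) * (of_int d * e i))"
        by (subst c[OF r(3)]) (simp add: sum_distrib_left mult_ac)
      also have "\<dots> = of_nat p * (\<Sum>i<N. of_int (c r i) * (\<Sum>j<Suc r. of_int (a i j) * e j))"
        using a by simp
      also have "\<dots> = of_nat p * (\<Sum>i<N. \<Sum>j<Suc r. of_int (c r i * a i j) * e j)"
        by (simp only: sum_distrib_left of_int_mult mult.assoc)
      also have "\<dots> = of_nat p * (\<Sum>j<Suc r. \<Sum>i<N. of_int (c r i * a i j) * e j)"
        by (subst sum.swap) simp
      also have "\<dots> = of_nat p * (\<Sum>j<Suc r. of_int (b j) * e j)"
        by (simp only: b_def of_int_sum sum_distrib_right)
      finally have er: "of_int u * e r = (\<Sum>j<r. of_int (int p * b j) * e j)"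
        by (simp add: u_def algebra_simps sum_distrib_left)
      have "\<exists>a' :: nat \<Rightarrow> int. of_int (u * d) * e i = (\<Sum>j<r. of_int (a' j) * e j)" if i: "i < N" for i
      proof
        have "of_int (u * d) * e i = of_int u * (\<Sum>j<Suc r. of_int (a i j) * e j)"
          using a[OF i] by (simp add: mult.assoc)
        also have "\<dots> = of_int u * (\<Sum>j<r. of_int (a i j) * e j) + of_int (a i r) * (of_int u * e r)"
          by (simp add: algebra_simps)
        also have "\<dots> = (\<Sum>j<r. of_int (u * a i j + a i r * (int p * b j)) * e j)"
          unfolding er by (simp add: sum_distrib_left sum.distrib algebra_simps)
        finally show "of_int (u * d) * e i = (\<Sum>j<r. of_int (u * a i j + a i r * (int p * b j)) * e j)" .
      qed
      moreover have "\<not> int p dvd u * d"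
      proof -
        have "\<not> int p dvd u" using d by (metis u_def diff_add_cancel dvd_add dvd_triv_left)
        then show ?thesis using d p by (simp add: prime_dvd_mult_iff)
      qed
      ultimately show ?thesis unfolding r(2) Q_def by blast
    next
      case False
      then show ?thesis using Suc by simp
    qed
  qed
  from this[of N] obtain d where "\<not> int p dvd d" "of_int d * e 0 = 0"
    using N unfolding Q_def by auto
  then show False using e0 by auto
qed

text \<open>By Zorn's lemma, the ideal generated by \<open>p\<close>, which is proper by assumption,
  lies in a maximal one, and maximal ideals are prime.\<close>

lemma exists_prime_residue:
  fixes R :: "'a::comm_ring_1 set"
  assumes p: "prime p" and R_one: "1 \<in> R"
    and R_diff: "\<And>x y. x \<in> R \<Longrightarrow> y \<in> R \<Longrightarrow> x - y \<in> R"
    and R_mult: "\<And>x y. x \<in> R \<Longrightarrow> y \<in> R \<Longrightarrow> x * y \<in> R"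
    and proper: "\<And>x. x \<in> R \<Longrightarrow> of_nat p * x \<noteq> 1"
  shows "\<exists>P. prime_residue R P p"
proof -
  define ideals where "ideals = {I. I \<subseteq> R \<and> (\<forall>x\<in>I. \<forall>y\<in>I. x - y \<in> I) \<and>
    (\<forall>x\<in>R. \<forall>y\<in>I. x * y \<in> I) \<and> of_nat p \<in> I \<and> 1 \<notin> I}"
  have R_zero: "0 \<in> R" using R_diff[OF R_one R_one] by simp
  have R_add: "x + y \<in> R" if "x \<in> R" "y \<in> R" for x y
    using R_diff[OF that(1) R_diff[OF R_zero that(2)]] by simp
  have R_of_nat: "of_nat k \<in> R" for k by (induction k) (auto intro: R_zero R_one R_add)
  have "(*) (of_nat p) ` R \<in> ideals"
    unfolding ideals_def
  proof (intro CollectI conjI ballI)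
    fix x y assume "x \<in> (*) (of_nat p) ` R" "y \<in> (*) (of_nat p) ` R"
    then obtain x' y' where "x = of_nat p * x'" "y = of_nat p * y'" "x' \<in> R" "y' \<in> R" by blast
    then show "x - y \<in> (*) (of_nat p) ` R"
      by (intro image_eqI[of _ _ "x' - y'"]) (simp_all add: R_diff right_diff_distrib)
  next
    fix x y assume x: "x \<in> R" and "y \<in> (*) (of_nat p) ` R"
    then obtain y' where "y = of_nat p * y'" "y' \<in> R" by blast
    then show "x * y \<in> (*) (of_nat p) ` R"
      using x by (intro image_eqI[of _ _ "x * y'"]) (simp_all add: R_mult mult_ac)
  next
    show "of_nat p \<in> (*) (of_nat p) ` R" using R_one by (intro image_eqI[of _ _ 1]) simp_all
  qed (use proper in \<open>force intro: R_mult R_of_nat\<close>)+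
  then have "\<exists>M\<in>ideals. \<forall>X\<in>ideals. M \<subseteq> X \<longrightarrow> X = M"
  proof (intro subset_Zorn_nonempty)
    fix C assume C: "C \<noteq> {}" "subset.chain ideals C"
    then have sub: "C \<subseteq> ideals" and lin: "\<And>I J. I \<in> C \<Longrightarrow> J \<in> C \<Longrightarrow> I \<subseteq> J \<or> J \<subseteq> I"
      by (auto simp: subset_chain_def)
    have diff: "x - y \<in> \<Union>C" if xy: "x \<in> \<Union>C" "y \<in> \<Union>C" for x y
    proof -
      obtain I J where IJ: "I \<in> C" "J \<in> C" "x \<in> I" "y \<in> J" using xy by blast
      then obtain K where "K \<in> C" "x \<in> K" "y \<in> K" using lin[OF IJ(1,2)] by blast
      then show ?thesis using sub unfolding ideals_def by blast
    qed
    have mult: "x * y \<in> \<Union>C" if "x \<in> R" "y \<in> \<Union>C" for x y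
      using that sub unfolding ideals_def by blast
    show "\<Union>C \<in> ideals"
      unfolding ideals_def using diff mult C(1) sub by (auto simp: ideals_def)
  qed auto
  then obtain P where P: "P \<in> ideals" and max: "\<And>I. I \<in> ideals \<Longrightarrow> P \<subseteq> I \<Longrightarrow> I = P" by blast
  have P_sub: "P \<subseteq> R" and P_diff: "\<And>x y. x \<in> P \<Longrightarrow> y \<in> P \<Longrightarrow> x - y \<in> P"
    and P_mult: "\<And>x y. x \<in> R \<Longrightarrow> y \<in> P \<Longrightarrow> x * y \<in> P" and p_P: "of_nat p \<in> P" and one_P: "1 \<notin> P"
    using P by (auto simp: ideals_def)
  have P_zero: "0 \<in> P" using P_diff[OF p_P p_P] by simp
  have P_add: "x + y \<in> P" if "x \<in> P" "y \<in> P" for x y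
    using P_diff[OF that(1) P_diff[OF P_zero that(2)]] by simp
  have prime: "x \<in> P \<or> y \<in> P" if xy: "x \<in> R" "y \<in> R" "x * y \<in> P" for x y
  proof (rule ccontr)
    assume neither: "\<not> ?thesis"
    \<comment> \<open>The ideal generated by \<open>P\<close> and \<open>x\<close> contains 1 by
      maximality; multiplying that representation of 1 by \<open>y\<close> puts \<open>y\<close>
      into \<open>P\<close>.\<close>
    define J where "J = {u + x * v | u v. u \<in> P \<and> v \<in> R}"
    have PJ: "P \<subseteq> J" unfolding J_def using R_zero by force
    have xJ: "x \<in> J" unfolding J_def using P_zero R_one by force
    have "J \<in> ideals" if "1 \<notin> J"
      unfolding ideals_def
    proof (intro CollectI conjI ballI)
      show "J \<subseteq> R" unfolding J_def using P_sub xy(1) R_add R_mult by blast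
      show "of_nat p \<in> J" using p_P PJ by blast
    next
      fix z w assume "z \<in> J" "w \<in> J"
      then obtain u v u' v' where zw: "z = u + x * v" "w = u' + x * v'"
        "u \<in> P" "u' \<in> P" "v \<in> R" "v' \<in> R" unfolding J_def by blast
      have "z - w = (u - u') + x * (v - v')" unfolding zw by (simp add: algebra_simps)
      then show "z - w \<in> J" unfolding J_def using P_diff[OF zw(3,4)] R_diff[OF zw(5,6)] by blast
    next
      fix z w assume z: "z \<in> R" and "w \<in> J"
      then obtain u v where w: "w = u + x * v" "u \<in> P" "v \<in> R" unfolding J_def by blast
      have "z * w = z * u + x * (z * v)" unfolding w by (simp add: algebra_simps)
      then show "z * w \<in> J" unfolding J_def using P_mult[OF z w(2)] R_mult[OF z w(3)] by blast
    qed (rule that)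
    then have "1 \<in> J" using max[OF _ PJ] xJ neither by blast
    then obtain u v where uv: "1 = u + x * v" "u \<in> P" "v \<in> R" unfolding J_def by blast
    have "y = y * (u + x * v)" using uv(1) by simp
    also have "\<dots> = y * u + v * (x * y)" by (simp add: algebra_simps)
    also have "\<dots> \<in> P" using P_add[OF P_mult[OF xy(2) uv(2)] P_mult[OF uv(3) xy(3)]] .
    finally show False using neither by blast
  qed
  have "prime_residue R P p"
    by unfold_locales (use p R_one R_diff R_mult P_sub P_diff P_mult p_P one_P prime in auto)
  then show ?thesis by blast
qed

text \<open>The representatives are 0 and the powers of a root of unity z of order N = p ^ n - 1. They are
incongruent: if z ^ k were congruent to 1 for some 0 < k < N, then summing z ^ (k i) over i < N would
give that N is congruent to 0, whereas N is congruent to -1.\<close>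

lemma exists_finite_prime_residue:
  assumes p: "prime p" and n: "n > 0"
  shows "\<exists>R P (T :: complex set). finite_prime_residue R P p n T"
proof -
  define N where "N = p ^ n - 1"
  have q: "p ^ n = Suc N" and N: "N > 0"
    using one_less_power[OF prime_gt_1_nat[OF p] n] by (auto simp: N_def)
  define z where "z = cis (2 * pi / N)"
  have zN: "z ^ N = 1" using N by (simp add: z_def DeMoivre)
  have z1: "z ^ k \<noteq> 1" if k: "0 < k" "k < N" for k
  proof
    assume "z ^ k = 1"
    then have "cos (2 * pi * (k / N)) = 1"
      by (simp add: z_def DeMoivre complex_eq_iff mult_ac)
    then obtain i :: int where "2 * pi * (k / N) = of_int i * 2 * pi"
      unfolding cos_one_2pi_int by blast
    then have "real k = of_int i * real N" using N by (simp add: field_simps)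
    then have "int k = i * int N" by (metis of_int_eq_iff of_int_mult of_int_of_nat_eq)
    then have "N dvd k" by (metis dvd_triv_right of_nat_dvd_iff)
    then show False using k by (auto dest: dvd_imp_le)
  qed
  have z_mod: "z ^ k = z ^ (k mod N)" for k
    by (metis zN mult_1 power_add power_mult power_one mult_div_mod_eq)
  \<comment> \<open>The ring generated by \<open>z\<close>, written as the span of finitely many
    powers so that \<open>int_span_not_p_divisible\<close> applies.\<close>
  define R where "R = range (\<lambda>a :: nat \<Rightarrow> int. \<Sum>k<N. of_int (a k) * z ^ k)"
  have R_diff: "x - y \<in> R" if "x \<in> R" "y \<in> R" for x y
  proof -
    obtain a b :: "nat \<Rightarrow> int"
      where "x = (\<Sum>k<N. of_int (a k) * z ^ k)" "y = (\<Sum>k<N. of_int (b k) * z ^ k)"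
      using \<open>x \<in> R\<close> \<open>y \<in> R\<close> unfolding R_def by blast
    then have "x - y = (\<Sum>k<N. of_int (a k - b k) * z ^ k)"
      by (simp add: left_diff_distrib sum_subtractf)
    then show ?thesis unfolding R_def by (rule range_eqI[of _ _ "\<lambda>k. a k - b k"])
  qed
  have R_monom: "of_int c * z ^ k \<in> R" for c k
  proof -
    have "of_int c * z ^ k = (\<Sum>j<N. of_int (if j = k mod N then c else 0) * z ^ j)"
      using N z_mod[of k] by (simp add: if_distrib[of of_int] if_distrib[of "\<lambda>x. x * _"] cong: if_cong)
    then show ?thesis
      unfolding R_def by (rule range_eqI[of _ _ "\<lambda>j. if j = k mod N then c else 0"])
  qed
  have R_zero: "0 \<in> R" using R_monom[of 0 0] by simp
  have R_add: "x + y \<in> R" if "x \<in> R" "y \<in> R" for x y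
    using R_diff[OF that(1) R_diff[OF R_zero that(2)]] by simp
  have R_sum: "sum f A \<in> R" if "\<And>i. i \<in> A \<Longrightarrow> f i \<in> R" for f and A :: "nat set"
    using that by (induction A rule: infinite_finite_induct) (auto intro: R_zero R_add)
  have R_mult: "x * y \<in> R" if "x \<in> R" "y \<in> R" for x y
  proof -
    obtain a b :: "nat \<Rightarrow> int"
      where "x = (\<Sum>k<N. of_int (a k) * z ^ k)" "y = (\<Sum>k<N. of_int (b k) * z ^ k)"
      using \<open>x \<in> R\<close> \<open>y \<in> R\<close> unfolding R_def by blast
    then have "x * y = (\<Sum>i<N. \<Sum>j<N. of_int (a i * b j) * z ^ (i + j))"
      by (simp add: sum_product power_add mult_ac)
    then show ?thesis by (simp only:) (intro R_sum R_monom)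
  qed
  have R_one: "1 \<in> R" using R_monom[of 1 0] by simp
  \<comment> \<open>If \<open>p\<close> were invertible in \<open>R\<close>, every
    \<open>z ^ i\<close> would be \<open>p\<close> times an element of \<open>R\<close>.\<close>
  have proper: "of_nat p * x \<noteq> 1" if x: "x \<in> R" for x
  proof
    assume px: "of_nat p * x = 1"
    obtain i where i: "i < N" "\<And>c. z ^ i \<noteq> of_nat p * (\<Sum>j<N. of_int (c j) * z ^ j)"
      using int_span_not_p_divisible[OF p N, of "\<lambda>i. z ^ i"] by auto
    have "x * z ^ i \<in> R" using R_mult[OF x] R_monom[of 1 i] by simp
    then obtain c :: "nat \<Rightarrow> int" where "x * z ^ i = (\<Sum>j<N. of_int (c j) * z ^ j)"
      unfolding R_def by blast
    moreover have "of_nat p * (x * z ^ i) = z ^ i" using px by (metis mult.assoc mult_1)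
    ultimately show False using i(2) by metis
  qed
  obtain P where "prime_residue R P p"
    using exists_prime_residue[OF p R_one R_diff R_mult proper] by blast
  then interpret prime_residue R P p .
  have zR: "z ^ k \<in> R" for k using R_monom[of 1 k] by simp
  have z_notin: "z ^ k \<notin> P" for k
  proof
    assume "z ^ k \<in> P"
    then have "z ^ (k * (N - 1)) * z ^ k \<in> P" using P_mult zR by blast
    moreover have "k * (N - 1) + k = N * k" using N by (cases N) auto
    ultimately have "1 \<in> P" by (metis power_add power_mult zN power_one)
    then show False using one_notin_P by blast
  qed
  have q_P: "of_nat (Suc N) \<in> P"
    unfolding q[symmetric] using P_mult[OF R_of_nat p_in_P, of "p ^ (n - 1)"] n
    by (metis of_nat_mult power_minus_mult)
  have z_diff: "z ^ k - 1 \<notin> P" if k: "0 < k" "k < N" for k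
  proof
    assume "z ^ k - 1 \<in> P"
    then have "eqv (z ^ k) 1" by (simp add: eqv_def)
    then have "eqv (\<Sum>i<N. (z ^ k) ^ i) (\<Sum>i<N. 1 ^ i)"
      using zR R_one by (intro eqv_sum eqv_power)
    moreover have "(\<Sum>i<N. (z ^ k) ^ i) = 0"
    proof -
      have "(z ^ k) ^ N = 1" by (metis power_mult mult.commute zN power_one)
      then show ?thesis using z1[OF k] by (simp add: geometric_sum)
    qed
    ultimately have "of_nat N \<in> P" using P_minus by (fastforce simp: eqv_def)
    then have "of_nat (Suc N) - of_nat N \<in> P" using q_P P_diff by blast
    then show False using one_notin_P by simp
  qed
  have less_case: "z ^ i - z ^ j \<notin> P" if ij: "i < j" "j < N" for i j
  proof
    assume "z ^ i - z ^ j \<in> P"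
    moreover have "z ^ j = z ^ i * z ^ (j - i)" using ij by (simp flip: power_add)
    ultimately have "z ^ i * (z ^ (j - i) - 1) \<in> P"
      using P_minus[of "z ^ i - z ^ j"] by (simp add: algebra_simps)
    moreover have "0 < j - i" "j - i < N" using ij by auto
    ultimately show False
      using P_prime[OF zR R_diff[OF zR R_one]] z_notin z_diff by blast
  qed
  have incong: "i = j" if "i < N" "j < N" "z ^ i - z ^ j \<in> P" for i j
    using less_case[of i j] less_case[of j i] that P_minus[of "z ^ i - z ^ j"]
    by (cases i j rule: linorder_cases) auto
  let ?T = "insert 0 ((\<lambda>k. z ^ k) ` {..<N})"
  have "finite_prime_residue R P p n ?T"
  proof unfold_locales
    show "n > 0" by fact
    show "?T \<subseteq> R" using R_zero zR by auto
    have "inj_on (\<lambda>k. z ^ k) {..<N}"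
      using incong P_zero by (intro inj_onI) auto
    moreover have "0 \<notin> (\<lambda>k. z ^ k) ` {..<N}" using z_notin P_zero by (metis imageE)
    ultimately show "card ?T = p ^ n" by (simp add: q card_image)
  next
    fix x y assume "x \<in> ?T" "y \<in> ?T" "x - y \<in> P"
    then show "x = y" using incong z_notin P_minus[of "x - y"] by auto
  next
    fix x assume "x \<in> R"
    then obtain a :: "nat \<Rightarrow> int" where x: "x = (\<Sum>k<N. of_int (a k) * z ^ k)"
      unfolding R_def by blast
    \<comment> \<open>Raising to the power \<open>p ^ n = Suc N\<close> fixes each
      \<open>z ^ k\<close>, hence modulo \<open>P\<close> every integer combination of them.\<close>
    have "(z ^ k) ^ N = 1" for k by (metis power_mult mult.commute zN power_one)
    then have "(z ^ k) ^ p ^ n = z ^ k" for k unfolding q by simp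
    then have "eqv (x ^ p ^ n) x"
      unfolding x using frobenius_sum[of "{..<N}" "\<lambda>k. z ^ k" a n] zR by simp
    then show "x ^ p ^ n - x \<in> P" by (simp add: eqv_def)
  qed
  then show ?thesis by blast
qed

section \<open>Codes over residue rings\<close>

text \<open>The condition at \<open>p\<close> depends only on the entries mod \<open>p\<close>, so
  the Gabidulin generators for the finitely many primes dividing \<open>h\<close> are glued
  entrywise by the Chinese remainder theorem.\<close>

lemma exists_code_generators:
  fixes h m n d :: nat
  assumes h: "h > 0" and "m \<le> n" "n > 0"
  shows "\<exists>G :: nat \<times> nat \<Rightarrow> nat \<Rightarrow> nat \<Rightarrow> int. \<forall>p a. prime p \<longrightarrow> p dvd h \<longrightarrow>
    (\<exists>k\<in>{..<d} \<times> {..<n}. \<not> int p dvd a k) \<longrightarrow>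
    card {x \<in> mod_vecs p m. \<forall>c<n. int p dvd (\<Sum>i<m. x i * (\<Sum>k\<in>{..<d} \<times> {..<n}. a k * G k i c))} < p ^ d"
proof -
  let ?I = "{..<d} \<times> {..<n}"
  define good where "good p G \<longleftrightarrow> (\<forall>a :: nat \<times> nat \<Rightarrow> int. (\<exists>k\<in>?I. \<not> int p dvd a k) \<longrightarrow>
    card {x \<in> mod_vecs p m. \<forall>c<n. int p dvd (\<Sum>i<m. x i * (\<Sum>k\<in>?I. a k * G k i c))} < p ^ d)"
    for p and G :: "nat \<times> nat \<Rightarrow> nat \<Rightarrow> nat \<Rightarrow> int"
  have "\<exists>G. good p G" if p: "prime p" for p
  proof -
    obtain R P and T :: "complex set" where "finite_prime_residue R P p n T"
      using exists_finite_prime_residue[OF p \<open>n > 0\<close>] by blast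
    then show ?thesis
      unfolding good_def using finite_prime_residue.exists_gabidulin_code[OF _ \<open>m \<le> n\<close>] by blast
  qed
  then obtain G where G: "\<And>p. prime p \<Longrightarrow> good p (G p)" by metis
  let ?S = "prime_factors h"
  have "\<exists>x. \<forall>p\<in>?S. [x = nat (G p k i c mod int p)] (mod p)" for k i c
    by (rule chinese_remainder_nat)
      (auto intro: primes_coprime dest: in_prime_factors_imp_prime)
  then obtain H where H: "\<And>k i c p. p \<in> ?S \<Longrightarrow> [H k i c = nat (G p k i c mod int p)] (mod p)"
    by metis
  have "good p (\<lambda>k i c. int (H k i c))" if p: "prime p" "p dvd h" for p
  proof -
    have cong: "[int (H k i c) = G p k i c] (mod int p)" for k i c
    proof -
      have "[int (H k i c) = int (nat (G p k i c mod int p))] (mod int p)"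
        unfolding cong_int_iff using H p h by (simp add: prime_factors_dvd)
      also have "int (nat (G p k i c mod int p)) = G p k i c mod int p"
        using prime_gt_0_nat[OF p(1)] by simp
      finally show ?thesis by (simp add: cong_def)
    qed
    have "[(\<Sum>i<m. x i * (\<Sum>k\<in>?I. a k * int (H k i c))) = (\<Sum>i<m. x i * (\<Sum>k\<in>?I. a k * G p k i c))] (mod int p)"
      for x a c
      by (intro cong_sum cong_mult cong_refl cong)
    then have "int p dvd (\<Sum>i<m. x i * (\<Sum>k\<in>?I. a k * int (H k i c)))
      \<longleftrightarrow> int p dvd (\<Sum>i<m. x i * (\<Sum>k\<in>?I. a k * G p k i c))" for x a c
      by (rule cong_dvd_iff)
    then show ?thesis using G[OF p(1)] unfolding good_def by simp
  qed
  then show ?thesis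
    unfolding good_def by (intro exI[of _ "\<lambda>k i c. int (H k i c)"]) simp
qed

text \<open>Dividing by the common content g of h and the coefficients exposes a prime p at which the
coefficients do not all vanish. Integer vectors killed by B exactly (not only mod h) still kill the
codeword after the division.\<close>

lemma codeword_not_low_rank:
  fixes h m n r :: nat and a :: "'k \<Rightarrow> int" and G :: "'k \<Rightarrow> nat \<Rightarrow> nat \<Rightarrow> int"
  assumes h: "h > 0" and r: "r' \<le> r" "r \<le> m"
    and G: "\<And>p a. prime p \<Longrightarrow> p dvd h \<Longrightarrow> \<exists>k\<in>I. \<not> int p dvd a k \<Longrightarrow>
      card {x \<in> mod_vecs p m. \<forall>c<n. int p dvd (\<Sum>i<m. x i * (\<Sum>k\<in>I. a k * G k i c))} < p ^ (m - r)"
    and a: "k \<in> I" "\<not> int h dvd a k"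
    and factors: "\<And>i j. i < m \<Longrightarrow> j < n \<Longrightarrow>
      int h dvd (\<Sum>k\<in>I. a k * G k i j) - (\<Sum>s<r'. B i s * C s j)"
  shows False
proof -
  define g where "g = Gcd (insert (int h) (a ` I))"
  have g_dvd: "g dvd int h" "\<And>k. k \<in> I \<Longrightarrow> g dvd a k"
    unfolding g_def by (rule Gcd_dvd; simp)+
  have g0: "g \<noteq> 0" using g_dvd(1) h by auto
  define h' where "h' = int h div g"
  define a' where "a' k = a k div g" for k
  have h': "int h = g * h'" using g_dvd by (simp add: h'_def)
  have a': "a k = g * a' k" if "k \<in> I" for k using g_dvd(2)[OF that] by (simp add: a'_def)
  \<comment> \<open>Otherwise \<open>h\<close> would divide \<open>g\<close> and thus every
    coefficient, contrary to the choice of \<open>k\<close>.\<close>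
  have "\<not> is_unit h'"
  proof
    assume "is_unit h'"
    then have "int h dvd g" using h' by (simp add: mult_unit_dvd_iff)
    then show False using g_dvd(2) a dvd_trans by blast
  qed
  moreover have "h' \<noteq> 0" using h h' by auto
  ultimately obtain q where q: "prime q" "q dvd h'"
    using prime_divisor_exists[of h'] by blast
  define p where "p = nat q"
  have qp: "q = int p" and p: "prime p"
    using q(1) by (auto simp: p_def prime_ge_0_int prime_nat_iff_prime intro: prime_int_nat_transfer[THEN iffD1])
  have "int p dvd int h" using q(2) h' qp by simp
  then have ph: "p dvd h" by simp
  \<comment> \<open>If not, \<open>g * p\<close> would be a common divisor of \<open>h\<close> and
    all coefficients, hence divide \<open>g\<close>.\<close>
  have "\<exists>k\<in>I. \<not> int p dvd a' k"
  proof (rule ccontr)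
    assume "\<not> ?thesis"
    then have "g * int p dvd a k" if "k \<in> I" for k using a' that by simp
    moreover have "g * int p dvd int h" using h' q(2) qp by simp
    ultimately have "g * int p dvd g" unfolding g_def by (intro Gcd_greatest) auto
    then show False using g0 p by (simp add: prime_gt_1_nat zdvd1_eq)
  qed
  then have small: "card {x \<in> mod_vecs p m. \<forall>c<n. int p dvd (\<Sum>i<m. x i * (\<Sum>k\<in>I. a' k * G k i c))}
      < p ^ (m - r)" (is "card ?X < _")
    by (intro G p ph)
  define L where "L = {x. (\<forall>i\<ge>m. x i = 0) \<and> (\<forall>s<r'. (\<Sum>i<m. x i * B i s) = 0)}"
  note L = card_left_kernel_mod[where m = m and r = r' and B = B, OF prime_gt_0_nat[OF p], folded L_def]
  have "mod_vec p ` L \<subseteq> ?X"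
  proof
    fix v assume v: "v \<in> mod_vec p ` L"
    then obtain x where x: "x \<in> L" "v = mod_vec p x" by blast
    have "int p dvd (\<Sum>i<m. v i * (\<Sum>k\<in>I. a' k * G k i c))" if c: "c < n" for c
    proof -
      let ?w = "\<lambda>i. \<Sum>k\<in>I. a' k * G k i c"
      \<comment> \<open>The product \<open>B C\<close> contributes nothing because \<open>x\<close>
        annihilates \<open>B\<close> over the integers; cancelling \<open>g\<close> then leaves
        divisibility by \<open>h'\<close>.\<close>
      have "int h dvd (\<Sum>i<m. x i * ((\<Sum>k\<in>I. a k * G k i c) - (\<Sum>s<r'. B i s * C s c)))"
        using factors c by (intro dvd_sum dvd_mult) auto
      also have "(\<Sum>i<m. x i * ((\<Sum>k\<in>I. a k * G k i c) - (\<Sum>s<r'. B i s * C s c)))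
        = (\<Sum>i<m. x i * (\<Sum>k\<in>I. a k * G k i c)) - (\<Sum>s<r'. (\<Sum>i<m. x i * B i s) * C s c)"
        by (subst sum_distrib_right, subst sum.swap)
          (simp add: right_diff_distrib sum_subtractf sum_distrib_left mult.assoc)
      also have "(\<Sum>s<r'. (\<Sum>i<m. x i * B i s) * C s c) = 0" using x(1) by (simp add: L_def)
      also have "(\<Sum>i<m. x i * (\<Sum>k\<in>I. a k * G k i c)) = g * (\<Sum>i<m. x i * ?w i)"
        using a' by (simp add: sum_distrib_left mult_ac)
      finally have "h' dvd (\<Sum>i<m. x i * ?w i)" using g0 by (simp add: h')
      then have px: "int p dvd (\<Sum>i<m. x i * ?w i)" using q(2) qp dvd_trans by blast
      have "[(\<Sum>i<m. v i * ?w i) = (\<Sum>i<m. x i * ?w i)] (mod int p)"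
        unfolding x(2) mod_vec_def by (intro cong_sum cong_mult cong_refl) (simp add: cong_def)
      then show ?thesis using px cong_dvd_iff by blast
    qed
    then show "v \<in> ?X" using v L(1) by blast
  qed
  then have "card (mod_vec p ` L) \<le> card ?X"
    using finite_mod_vecs by (intro card_mono) auto
  then have "p ^ r' * card (mod_vec p ` L) < p ^ r' * p ^ (m - r)"
    using small p prime_gt_0_nat by simp
  also have "\<dots> \<le> p ^ m"
    unfolding power_add[symmetric] using r prime_gt_0_nat[OF p] by (intro power_increasing) auto
  finally show False using L(2) by simp
qed

section \<open>Inner rank and the complement graph\<close>

text \<open>The identity matrix as left factor shows that the least value is attained. It may lie
  below \<open>r\<close>, hence the separate \<open>r'\<close>.\<close>

lemma inner_rank_leD:
  assumes h: "h \<ge> 2" and A: "A \<in> zmat h m n" and rank: "inner_rank h m n A \<le> r"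
  obtains r' B C where "r' \<le> r" "B \<in> zmat h m r'" "C \<in> zmat h r' n" "A = zmat_mult h m r' n B C"
proof -
  let ?P = "\<lambda>r. \<exists>B C. B \<in> zmat h m r \<and> C \<in> zmat h r n \<and> A = zmat_mult h m r n B C"
  let ?B = "\<lambda>i j. if i < m \<and> i = j then 1 else 0"
  have "?B \<in> zmat h m m" using h by (auto simp: zmat_def)
  moreover have "A = zmat_mult h m m n ?B A"
  proof (intro ext)
    fix i j
    show "A i j = zmat_mult h m m n ?B A i j"
      using A by (auto simp: zmat_mult_def zmat_def if_distrib[of "\<lambda>x. x * _"] cong: if_cong)
  qed
  ultimately have "?P m" using A by blast
  then have "?P (inner_rank h m n A)" unfolding inner_rank_def by (rule LeastI)
  then show ?thesis using that rank by blast
qed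

lemma inner_rank_leI:
  assumes "B \<in> zmat h m r" "C \<in> zmat h r n" "A = zmat_mult h m r n B C"
  shows "inner_rank h m n A \<le> r"
  unfolding inner_rank_def using assms by (intro Least_le) blast

lemma zmat_sub_in_zmat: "h > 0 \<Longrightarrow> zmat_sub h m n A B \<in> zmat h m n"
  by (auto simp: zmat_sub_def zmat_def)

text \<open>Only the first \<open>r\<close> rows of the difference can be nonzero: \<open>?C\<close>
  consists of these rows and \<open>?B\<close> is an identity block above zeros.\<close>

lemma inner_rank_sub_le_if_lower_rows_eq:
  assumes h: "h \<ge> 2" and r: "r \<le> m"
    and eq: "\<And>i j. r \<le> i \<Longrightarrow> i < m \<Longrightarrow> j < n \<Longrightarrow> A i j = B i j"
  shows "inner_rank h m n (zmat_sub h m n A B) \<le> r"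
proof (rule inner_rank_leI)
  let ?B = "\<lambda>i j. if i < r \<and> i = j then 1 else 0"
  let ?C = "\<lambda>i j. if i < r \<and> j < n then (A i j - B i j) mod int h else 0"
  show "?B \<in> zmat h m r" using h r by (auto simp: zmat_def)
  show "?C \<in> zmat h r n" using h by (auto simp: zmat_def)
  show "zmat_sub h m n A B = zmat_mult h m r n ?B ?C"
  proof (intro ext)
    fix i j
    show "zmat_sub h m n A B i j = zmat_mult h m r n ?B ?C i j"
      using eq[of i j]
      by (cases "i < r") (auto simp: zmat_mult_def zmat_sub_def if_distrib[of "\<lambda>x. x * _"] cong: if_cong)
  qed
qed

text \<open>The colouring. Restriction places the colours in a function space with
  \<open>h ^ (n * (m - r))\<close> elements.\<close>

definition lower_rows :: "nat \<Rightarrow> nat \<Rightarrow> nat \<Rightarrow> (nat \<Rightarrow> nat \<Rightarrow> int) \<Rightarrow> nat \<times> nat \<Rightarrow> int" where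
  "lower_rows r m n A = restrict (\<lambda>(i, j). A i j) ({r..<m} \<times> {..<n})"

lemma lower_rows_eqD:
  "lower_rows r m n A = lower_rows r m n B \<Longrightarrow> r \<le> i \<Longrightarrow> i < m \<Longrightarrow> j < n \<Longrightarrow> A i j = B i j"
  unfolding lower_rows_def by (drule fun_cong[of _ _ "(i, j)"]) simp

lemma lower_rows_image:
  "lower_rows r m n ` zmat h m n \<subseteq> ({r..<m} \<times> {..<n}) \<rightarrow>\<^sub>E {0..<int h}"
proof (intro image_subsetI)
  fix A assume "A \<in> zmat h m n"
  then show "lower_rows r m n A \<in> ({r..<m} \<times> {..<n}) \<rightarrow>\<^sub>E {0..<int h}"
    unfolding lower_rows_def restrict_PiE_iff by (auto simp: zmat_def)
qed

lemma finite_zmat: "finite (zmat h m n)"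
proof (rule inj_on_finite)
  show "inj_on (lower_rows 0 m n) (zmat h m n)"
  proof (intro inj_onI ext)
    fix A B i j
    assume "A \<in> zmat h m n" "B \<in> zmat h m n" "lower_rows 0 m n A = lower_rows 0 m n B"
    then show "A i j = B i j"
      using lower_rows_eqD[of 0 m n A B i j] by (cases "i < m \<and> j < n") (auto simp: zmat_def)
  qed
  show "lower_rows 0 m n ` zmat h m n \<subseteq> ({0..<m} \<times> {..<n}) \<rightarrow>\<^sub>E {0..<int h}"
    by (rule lower_rows_image)
  show "finite (({0..<m} \<times> {..<n}) \<rightarrow>\<^sub>E {0..<int h})" by (intro finite_PiE) auto
qed

lemma exists_sigma_clique:
  assumes h: "h \<ge> 2" and r: "r \<le> m" and mn: "m \<le> n" "n > 0"
  shows "\<exists>K. is_clique (zmat h m n) (sigma_adj h m n r) K \<and> finite K \<and> card K = h ^ (n * (m - r))"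
proof -
  let ?I = "{..<m - r} \<times> {..<n}"
  have "\<exists>G :: nat \<times> nat \<Rightarrow> nat \<Rightarrow> nat \<Rightarrow> int. \<forall>p a. prime p \<longrightarrow> p dvd h \<longrightarrow>
    (\<exists>k\<in>?I. \<not> int p dvd a k) \<longrightarrow>
    card {x \<in> mod_vecs p m. \<forall>c<n. int p dvd (\<Sum>i<m. x i * (\<Sum>k\<in>?I. a k * G k i c))} < p ^ (m - r)"
    using h by (intro exists_code_generators mn) simp
  then obtain G :: "nat \<times> nat \<Rightarrow> nat \<Rightarrow> nat \<Rightarrow> int" where
    G: "\<And>p a. prime p \<Longrightarrow> p dvd h \<Longrightarrow> \<exists>k\<in>?I. \<not> int p dvd a k \<Longrightarrow>
      card {x \<in> mod_vecs p m. \<forall>c<n. int p dvd (\<Sum>i<m. x i * (\<Sum>k\<in>?I. a k * G k i c))} < p ^ (m - r)"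
    by blast
  define M where "M a = (\<lambda>i j. if i < m \<and> j < n then (\<Sum>k\<in>?I. a k * G k i j) mod int h else 0)" for a
  let ?D = "?I \<rightarrow>\<^sub>E {0..<int h}"
  have M_zmat: "M a \<in> zmat h m n" for a using h by (auto simp: M_def zmat_def)
  \<comment> \<open>The difference of two codewords is, mod \<open>h\<close>, the codeword with
    coefficients \<open>a k - b k\<close>, and one of these is nonzero mod \<open>h\<close>.\<close>
  have no_factors: False
    if ab: "a \<in> ?D" "b \<in> ?D" "a \<noteq> b" and r': "r' \<le> r"
      and sub: "zmat_sub h m n (M a) (M b) = zmat_mult h m r' n B C" for a b r' B C
  proof -
    obtain k where k: "k \<in> ?I" "a k \<noteq> b k" using ab by (metis PiE_ext)
    show False
    proof (rule codeword_not_low_rank[where a = "\<lambda>k. a k - b k", OF _ r' r G])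
      show "h > 0" using h by simp
      show "k \<in> ?I" by (rule k)
      show "\<not> int h dvd a k - b k"
      proof
        assume "int h dvd a k - b k"
        then have "a k mod int h = b k mod int h" by (simp add: mod_eq_dvd_iff)
        moreover have "a k \<in> {0..<int h}" "b k \<in> {0..<int h}" using ab k by blast+
        ultimately show False using k by simp
      qed
    next
      fix i j assume ij: "i < m" "j < n"
      have "(M a i j - M b i j) mod int h = (\<Sum>s<r'. B i s * C s j) mod int h"
        using fun_cong[OF fun_cong[OF sub], of i j] ij by (simp add: zmat_sub_def zmat_mult_def)
      moreover have "(M a i j - M b i j) mod int h = (\<Sum>k\<in>?I. (a k - b k) * G k i j) mod int h"
        using ij by (simp add: M_def mod_diff_eq left_diff_distrib sum_subtractf)
      ultimately show "int h dvd (\<Sum>k\<in>?I. (a k - b k) * G k i j) - (\<Sum>s<r'. B i s * C s j)"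
        by (simp add: mod_eq_dvd_iff)
    qed
  qed
  have M_inj: "M a \<noteq> M b" if "a \<in> ?D" "b \<in> ?D" "a \<noteq> b" for a b
  proof
    assume "M a = M b"
    \<comment> \<open>Equal codewords are the case of an empty factorization,
      \<open>r' = 0\<close>.\<close>
    then have "zmat_sub h m n (M a) (M b) = zmat_mult h m 0 n (\<lambda>_ _. 0) (\<lambda>_ _. 0)"
      by (simp add: zmat_sub_def zmat_mult_def fun_eq_iff)
    then show False using no_factors that by blast
  qed
  have "is_clique (zmat h m n) (sigma_adj h m n r) (M ` ?D)"
    unfolding is_clique_def
  proof (intro conjI ballI impI)
    show "M ` ?D \<subseteq> zmat h m n" using M_zmat by auto
    fix A B assume "A \<in> M ` ?D" "B \<in> M ` ?D" and AB: "A \<noteq> B"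
    then obtain a b where ab: "a \<in> ?D" "b \<in> ?D" "A = M a" "B = M b" by blast
    have "\<not> inner_rank h m n (zmat_sub h m n A B) \<le> r"
    proof
      assume "inner_rank h m n (zmat_sub h m n A B) \<le> r"
      then obtain r' B' C' where "r' \<le> r" "zmat_sub h m n A B = zmat_mult h m r' n B' C'"
        using inner_rank_leD[OF h zmat_sub_in_zmat] h by (metis zero_less_numeral less_le_trans)
      then show False using no_factors ab AB by blast
    qed
    then show "sigma_adj h m n r A B" using AB by (simp add: sigma_adj_def bil_adj_def)
  qed
  moreover have "card (M ` ?D) = h ^ (n * (m - r))"
    using M_inj by (subst card_image) (auto simp: inj_on_def card_PiE mult.commute)
  moreover have "finite (M ` ?D)" by (intro finite_imageI finite_PiE) auto
  ultimately show ?thesis by blast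
qed

theorem theorem3p11:
  fixes h m n r :: nat
  assumes "h \<ge> 2"
    and "1 \<le> r" and "r \<le> m" and "m \<le> n"
  shows "chromatic_number (zmat h m n) (sigma_adj h m n r) = h ^ (n * (m - r))
       \<and> clique_number (zmat h m n) (sigma_adj h m n r) = h ^ (n * (m - r))
       \<and> indep_number (zmat h m n) (bil_adj h m n r) = h ^ (n * (m - r))
       \<and> (\<exists>S F. is_core_of S F (zmat h m n) (sigma_adj h m n r))
       \<and> (\<forall>S F. is_core_of S F (zmat h m n) (sigma_adj h m n r) \<longrightarrow>
            is_clique (zmat h m n) (sigma_adj h m n r) S
            \<and> card S = clique_number (zmat h m n) (sigma_adj h m n r)
            \<and> (\<forall>x y. F x y \<longleftrightarrow> x \<in> S \<and> y \<in> S \<and> sigma_adj h m n r x y))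
       \<and> \<not> is_core (zmat h m n) (sigma_adj h m n r)"
proof -
  let ?V = "zmat h m n" and ?E = "sigma_adj h m n r"
  let ?c = "lower_rows r m n" and ?X = "({r..<m} \<times> {..<n}) \<rightarrow>\<^sub>E {0..<int h}"
  obtain K where K: "is_clique ?V ?E K" "finite K" "card K = h ^ (n * (m - r))"
    using exists_sigma_clique[of h r m n] assms by auto
  have X: "finite ?X" "card ?X = h ^ (n * (m - r))"
    by (auto intro!: finite_PiE simp: card_PiE mult.commute)
  have proper: "?c A \<noteq> ?c B" if AB: "A \<in> ?V" "B \<in> ?V" "?E A B" for A B
  proof
    assume "?c A = ?c B"
    then have "inner_rank h m n (zmat_sub h m n A B) \<le> r"
      using assms by (intro inner_rank_sub_le_if_lower_rows_eq) (auto dest: lower_rows_eqD)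
    then show False using AB by (auto simp: sigma_adj_def bil_adj_def)
  qed
  have zero: "(\<lambda>_ _. 0) \<in> ?V" using assms by (auto simp: zmat_def)
  have irrefl: "\<not> ?E A A" for A by (simp add: sigma_adj_def)
  have card_KX: "card K = card ?X" using K X by simp
  have nonempty: "?V \<noteq> {}" using zero by blast
  note facts = X(1) lower_rows_image proper K(1,2) card_KX finite_zmat nonempty
  have clique: "clique_number ?V ?E = card K" by (rule clique_number_eq_card_clique[OF facts])
  have "is_indep ?V (bil_adj h m n r) S \<longleftrightarrow> is_clique ?V ?E S" for S
    by (auto simp: is_indep_def is_clique_def sigma_adj_def bil_adj_def)
  then have indep: "indep_number ?V (bil_adj h m n r) = clique_number ?V ?E"
    by (simp add: indep_number_def clique_number_def)
  \<comment> \<open>Since \<open>r >= 1\<close>, this matrix and 0 agree in the lower rows, so they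
    are distinct and nonadjacent in the complement graph. Hence \<open>K\<close> is not the whole
    vertex set and the graph is not a core.\<close>
  let ?U = "\<lambda>i j. if i = 0 \<and> j = 0 then 1 else (0::int)"
  have U: "?U \<in> ?V" using assms by (auto simp: zmat_def)
  have U0: "?U \<noteq> (\<lambda>_ _. 0)" by (auto simp: fun_eq_iff)
  have "inner_rank h m n (zmat_sub h m n ?U (\<lambda>_ _. 0)) \<le> r"
    using assms by (intro inner_rank_sub_le_if_lower_rows_eq) auto
  then have "\<not> ?E ?U (\<lambda>_ _. 0)" using U0 by (simp add: sigma_adj_def bil_adj_def)
  then have "K \<noteq> ?V" using K(1) U zero U0 unfolding is_clique_def by blast
  then have less: "card K < card ?V"
    using K(1) finite_zmat by (intro psubset_card_mono) (auto simp: is_clique_def)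
  show ?thesis
    unfolding clique indep K(3)[symmetric]
    using chromatic_number_eq_card_clique[OF facts] clique_is_core[OF facts irrefl]
      core_is_max_clique[OF facts irrefl] not_core_if_clique_smaller[OF facts less]
    by (intro conjI allI impI) blast+
qed

end
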